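(* There is a nontrivial exact sequence of Banach spaces $$0\longrightarrow Z_2\longrightarrow \ell_2\oplus\mathscr Z^{(3)}\longrightarrow Z_2\longrightarrow 0,$$ where $Z_2$ is the Kalton–Peck space and $\mathscr Z^{(3)}$ is the space of triples of Taylor coefficients at $1/2$ built from the couple $(\ell_\infty,\ell_1)$.
   Context: Let $\mathbb S=\{z\in\mathbb C:0<\Re z<1\}$ and consider complex sequence spaces $\ell_\infty=\ell_\infty(\mathbb N)$, $\ell_1=\ell_1(\mathbb N)$, $\ell_2=\ell_2(\mathbb N)$. Let $\mathscr F$ be the Banach space of bounded analytic functions $F:\mathbb S\to\ell_\infty$ such that (1) $F$ extends to a $\sigma(\ell_\infty,\ell_1)$-continuous function on $\overline{\mathbb S}$, again denoted $F$; (2) $\|F\|_{\mathscr F}=\sup\{\|F(it)\|_\infty,\ \|F(1+it)\|_1: t\in\mathbb R\}<\infty$. For $n\ge1$, $$\mathscr Z^{(n)}=\Big\{(x_{n-1},\dots,x_0)\in(\ell_\infty)^n:\ \exists f\in\mathscr F,\ x_i=\tfrac{1}{i!}f^{(i)}(\tfrac12)\text{ for all }0\le i<n\Big\},$$ with norm the infimum of $\|f\|_{\mathscr F}$ over all such $f$. The Kalton–Peck space $Z_2$ is, up to isomorphism, $$Z_2=\Big\{(y,x)\in\ell_\infty\times\ell_2:\ y-2x\log\big(|x|/\|x\|_2\big)\in\ell_2\Big\},\qquad \|(y,x)\|=\Big\|y-2x\log\big(|x|/\|x\|_2\big)\Big\|_2+\|x\|_2,$$ (operations coordinatewise, with $0\log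 0=0$ and the logarithmic term equal to $0$ when $x=0$); this quasinorm is equivalent to a norm, and $Z_2$ is isomorphic to $\mathscr Z^{(2)}$. An exact sequence $0\to A\xrightarrow{I}B\xrightarrow{Q}C\to0$ of Banach spaces and bounded operators is trivial if there is a bounded operator $P:B\to A$ with $P\circ I=\mathbf 1_A$, and nontrivial otherwise. *)

theory Defs
  imports "HOL-Analysis.Analysis" "HOL-Library.Function_Algebras"
begin

section \<open>Complex Banach spaces carried by subspaces\<close>

class complex_vector = ab_group_add +
  fixes scaleC :: "complex \<Rightarrow> 'a \<Rightarrow> 'a"  (infixr "*\<^sub>C" 75)
  assumes scaleC_add_right: "a *\<^sub>C (x + y) = a *\<^sub>C x + a *\<^sub>C y"
    and scaleC_add_left: "(a + b) *\<^sub>C x = a *\<^sub>C x + b *\<^sub>C x"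
    and scaleC_scaleC: "a *\<^sub>C b *\<^sub>C x = (a * b) *\<^sub>C x"
    and scaleC_one: "1 *\<^sub>C x = x"

instantiation complex :: complex_vector
begin
definition scaleC_complex_def: "a *\<^sub>C (x::complex) = a * x"
instance by standard (simp_all add: scaleC_complex_def algebra_simps)
end

instantiation "fun" :: (type, complex_vector) complex_vector
begin
definition scaleC_fun_def: "a *\<^sub>C f = (\<lambda>k. a *\<^sub>C f k)"
instance
  by standard
    (simp_all add: scaleC_fun_def fun_eq_iff scaleC_add_right scaleC_add_left
      scaleC_scaleC scaleC_one)
end

instantiation prod :: (complex_vector, complex_vector) complex_vector
begin
definition scaleC_prod_def: "a *\<^sub>C x = (a *\<^sub>C fst x, a *\<^sub>C snd x)"
instance
  by standard
    (simp_all add: scaleC_prod_def prod_eq_iff scaleC_add_right scaleC_add_left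
      scaleC_scaleC scaleC_one)
end

definition csubspace :: "'a::complex_vector set \<Rightarrow> bool" where
  "csubspace V \<longleftrightarrow> 0 \<in> V \<and> (\<forall>x\<in>V. \<forall>y\<in>V. x + y \<in> V) \<and> (\<forall>a. \<forall>x\<in>V. a *\<^sub>C x \<in> V)"

definition norm_on :: "'a::complex_vector set \<Rightarrow> ('a \<Rightarrow> real) \<Rightarrow> bool" where
  "norm_on V N \<longleftrightarrow>
     (\<forall>x\<in>V. 0 \<le> N x) \<and>
     (\<forall>x\<in>V. N x = 0 \<longleftrightarrow> x = 0) \<and>
     (\<forall>a. \<forall>x\<in>V. N (a *\<^sub>C x) = cmod a * N x) \<and>
     (\<forall>x\<in>V. \<forall>y\<in>V. N (x + y) \<le> N x + N y)"

definition complete_on :: "'a::complex_vector set \<Rightarrow> ('a \<Rightarrow> real) \<Rightarrow> bool" where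
  "complete_on V N \<longleftrightarrow>
     (\<forall>X :: nat \<Rightarrow> 'a. (\<forall>n. X n \<in> V) \<and>
        (\<forall>e>0. \<exists>M. \<forall>m\<ge>M. \<forall>n\<ge>M. N (X m - X n) < e) \<longrightarrow>
        (\<exists>x\<in>V. (\<lambda>n. N (X n - x)) \<longlonglongrightarrow> 0))"

definition banach_on :: "'a::complex_vector set \<Rightarrow> ('a \<Rightarrow> real) \<Rightarrow> bool" where
  "banach_on V N \<longleftrightarrow> csubspace V \<and> norm_on V N \<and> complete_on V N"

definition equivalent_on :: "'a set \<Rightarrow> ('a \<Rightarrow> real) \<Rightarrow> ('a \<Rightarrow> real) \<Rightarrow> bool" where
  "equivalent_on V q N \<longleftrightarrow> (\<exists>c>0. \<exists>C>0. \<forall>x\<in>V. c * q x \<le> N x \<and> N x \<le> C * q x)"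

definition bounded_operator ::
  "'a::complex_vector set \<Rightarrow> ('a \<Rightarrow> real) \<Rightarrow> 'b::complex_vector set \<Rightarrow> ('b \<Rightarrow> real) \<Rightarrow> ('a \<Rightarrow> 'b) \<Rightarrow> bool"
  where
  "bounded_operator V NV W NW T \<longleftrightarrow>
     (\<forall>x\<in>V. T x \<in> W) \<and>
     (\<forall>x\<in>V. \<forall>y\<in>V. T (x + y) = T x + T y) \<and>
     (\<forall>a. \<forall>x\<in>V. T (a *\<^sub>C x) = a *\<^sub>C T x) \<and>
     (\<exists>K. \<forall>x\<in>V. NW (T x) \<le> K * NV x)"

text \<open>\<open>0 \<rightarrow> A \<rightarrow> B \<rightarrow> C \<rightarrow> 0\<close> with maps \<open>I\<close> and \<open>Q\<close>.\<close>

definition exact_sequence ::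
  "'a::complex_vector set \<Rightarrow> ('a \<Rightarrow> real) \<Rightarrow> 'b::complex_vector set \<Rightarrow> ('b \<Rightarrow> real) \<Rightarrow>
   'c::complex_vector set \<Rightarrow> ('c \<Rightarrow> real) \<Rightarrow> ('a \<Rightarrow> 'b) \<Rightarrow> ('b \<Rightarrow> 'c) \<Rightarrow> bool"
  where
  "exact_sequence A NA B NB C NC I Q \<longleftrightarrow>
     banach_on A NA \<and> banach_on B NB \<and> banach_on C NC \<and>
     bounded_operator A NA B NB I \<and> bounded_operator B NB C NC Q \<and>
     inj_on I A \<and> I ` A = {b \<in> B. Q b = 0} \<and> Q ` B = C"

definition trivial_sequence ::
  "'a::complex_vector set \<Rightarrow> ('a \<Rightarrow> real) \<Rightarrow> 'b::complex_vector set \<Rightarrow> ('b \<Rightarrow> real) \<Rightarrow> ('a \<Rightarrow> 'b) \<Rightarrow> bool"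
  where
  "trivial_sequence A NA B NB I \<longleftrightarrow>
     (\<exists>P. bounded_operator B NB A NA P \<and> (\<forall>x\<in>A. P (I x) = x))"

definition sum_norm :: "('a \<Rightarrow> real) \<Rightarrow> ('b \<Rightarrow> real) \<Rightarrow> 'a \<times> 'b \<Rightarrow> real" where
  "sum_norm NV NW = (\<lambda>(v, w). NV v + NW w)"

section \<open>Sequence spaces\<close>

type_synonym cseq = "nat \<Rightarrow> complex"

definition linf :: "cseq set" where
  "linf = {x. bounded (range x)}"

definition linf_norm :: "cseq \<Rightarrow> real" where
  "linf_norm x = (SUP k. cmod (x k))"

definition l1 :: "cseq set" where
  "l1 = {x. summable (\<lambda>k. cmod (x k))}"

definition l1_norm :: "cseq \<Rightarrow> real" where
  "l1_norm x = (\<Sum>k. cmod (x k))"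

definition l2 :: "cseq set" where
  "l2 = {x. summable (\<lambda>k. (cmod (x k))\<^sup>2)}"

definition l2_norm :: "cseq \<Rightarrow> real" where
  "l2_norm x = sqrt (\<Sum>k. (cmod (x k))\<^sup>2)"

section \<open>The Kalton--Peck space\<close>

text \<open>Since \<^term>\<open>x k\<close> is a factor, the value is \<open>0\<close> wherever \<^prop>\<open>x k = 0\<close>, in particular
  everywhere if \<^prop>\<open>x = 0\<close>.\<close>

definition kp_map :: "cseq \<Rightarrow> cseq" where
  "kp_map x = (\<lambda>k. 2 * x k * of_real (ln (cmod (x k) / l2_norm x)))"

definition Z2 :: "(cseq \<times> cseq) set" where
  "Z2 = {(y, x). y \<in> linf \<and> x \<in> l2 \<and> y - kp_map x \<in> l2}"

definition Z2_quasinorm :: "cseq \<times> cseq \<Rightarrow> real" where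
  "Z2_quasinorm = (\<lambda>(y, x). l2_norm (y - kp_map x) + l2_norm x)"

section \<open>The Calderon space and the Taylor coefficient spaces\<close>

definition strip :: "complex set" where
  "strip = {z. 0 < Re z \<and> Re z < 1}"

definition closed_strip :: "complex set" where
  "closed_strip = {z. 0 \<le> Re z \<and> Re z \<le> 1}"

text \<open>Complex derivatives of \<^term>\<open>linf\<close>-valued functions, with respect to \<^term>\<open>linf_norm\<close>.\<close>

definition has_linf_derivative :: "(complex \<Rightarrow> cseq) \<Rightarrow> cseq \<Rightarrow> complex \<Rightarrow> bool" where
  "has_linf_derivative F D z \<longleftrightarrow> D \<in> linf \<and>
     ((\<lambda>w. linf_norm (inverse (w - z) *\<^sub>C (F w - F z) - D)) \<longlongrightarrow> 0) (at z)"

definition linf_deriv :: "(complex \<Rightarrow> cseq) \<Rightarrow> complex \<Rightarrow> cseq" where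
  "linf_deriv F z = (THE D. has_linf_derivative F D z)"

text \<open>A function on the closed strip is represented by any function on \<^typ>\<open>complex\<close>
  that restricts to it; nothing below depends on the values off \<^term>\<open>closed_strip\<close>.\<close>

definition weak_star_continuous_on :: "complex set \<Rightarrow> (complex \<Rightarrow> cseq) \<Rightarrow> bool" where
  "weak_star_continuous_on S F \<longleftrightarrow>
     (\<forall>a\<in>l1. continuous_on S (\<lambda>z. \<Sum>k. F z k * a k))"

definition boundary_norms :: "(complex \<Rightarrow> cseq) \<Rightarrow> real set" where
  "boundary_norms F =
     range (\<lambda>t::real. linf_norm (F (\<i> * of_real t))) \<union>
     range (\<lambda>t::real. l1_norm (F (1 + \<i> * of_real t)))"

definition calF :: "(complex \<Rightarrow> cseq) set" where
  "calF = {F.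
     (\<forall>z\<in>closed_strip. F z \<in> linf) \<and>
     bdd_above ((\<lambda>z. linf_norm (F z)) ` strip) \<and>
     (\<forall>z\<in>strip. \<exists>D. has_linf_derivative F D z) \<and>
     weak_star_continuous_on closed_strip F \<and>
     (\<forall>t::real. F (1 + \<i> * of_real t) \<in> l1) \<and>
     bdd_above (boundary_norms F)}"

definition calF_norm :: "(complex \<Rightarrow> cseq) \<Rightarrow> real" where
  "calF_norm F = Sup (boundary_norms F)"

text \<open>The \<open>n\<close>-tuple \<open>(x\<^bsub>n-1\<^esub>, \<dots>, x\<^bsub>0\<^esub>)\<close> is represented by the function \<open>i \<mapsto> x\<^bsub>i\<^esub>\<close>,
  extended by \<open>0\<close> to \<open>i \<ge> n\<close>.\<close>

definition taylor_lifts :: "nat \<Rightarrow> (nat \<Rightarrow> cseq) \<Rightarrow> (complex \<Rightarrow> cseq) set" where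
  "taylor_lifts n x =
     {F \<in> calF. \<forall>i<n. x i = inverse (fact i) *\<^sub>C (linf_deriv ^^ i) F (1/2)}"

definition calZ :: "nat \<Rightarrow> (nat \<Rightarrow> cseq) set" where
  "calZ n = {x. (\<forall>i<n. x i \<in> linf) \<and> (\<forall>i\<ge>n. x i = 0) \<and> taylor_lifts n x \<noteq> {}}"

definition calZ_norm :: "nat \<Rightarrow> (nat \<Rightarrow> cseq) \<Rightarrow> real" where
  "calZ_norm n x = Inf (calF_norm ` taylor_lifts n x)"

end

theory Submission
  imports Defs "HOL-Complex_Analysis.Complex_Analysis"
begin

text \<open>
  Everything is read off from the Taylor coefficients at \<open>1/2\<close> of functions in \<^const>\<open>calF\<close>.
  Write \<open>F\<close> for such a function and put \<open>w = z - 1/2\<close>.  The scalar function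
  \<open>\<phi>(z) = w e\<^sup>w / (1 + w)\<close> vanishes to first order at the centre of the strip only, is bounded,
  and \<open>1/\<phi>\<close> is bounded on the boundary of the strip.  Hence multiplication by \<open>\<phi>\<close> maps
  \<^const>\<open>calF\<close> onto the functions that vanish at \<open>1/2\<close>, with a bounded inverse.  Since
  \<open>\<phi> = w + O(w\<^sup>3)\<close>, multiplication by \<open>\<phi>\<close> shifts Taylor coefficients by one place, up to order two.

  The values \<open>F(1/2)\<close> fill exactly \<^const>\<open>l2\<close>: one inclusion is the duality estimate
  \<open>pairing_value\<close>, the other is witnessed by the function \<open>extremal x\<close>, whose derivative at
  \<open>1/2\<close> is \<^term>\<open>kp_map x\<close>.  Two functions with the same value \<open>x\<close> differ by a multiple of
  \<open>\<phi>\<close>, so their derivatives differ by a vector of \<^const>\<open>l2\<close>.  This gives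
  \<open>Z2 = {(F'(1/2), F(1/2))}\<close>, and the quotient norm obtained from \<^const>\<open>calF\<close> is equivalent to the
  Kalton--Peck quasinorm.

  The Taylor triples \<open>(x\<^sub>2, x\<^sub>1, x\<^sub>0)\<close> are mapped onto \<^const>\<open>Z2\<close> by
  \<open>(x\<^sub>2, x\<^sub>1, x\<^sub>0) \<mapsto> (x\<^sub>1, x\<^sub>0)\<close>, and \<^const>\<open>l2\<close> embeds in \<^const>\<open>Z2\<close> by \<open>v \<mapsto> (v, 0)\<close>.
  The pullback of these two maps gives the sequence with \<open>I (y, x) = (x, (y, x, 0))\<close> and
  \<open>Q (v, (x\<^sub>2, x\<^sub>1, x\<^sub>0)) = (x\<^sub>1 - v, x\<^sub>0)\<close>.  It is exact because a triple
  with \<open>x\<^sub>0 = 0\<close> comes from a multiple of \<open>\<phi>\<close>.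

  For nontriviality, suppose that \<open>P\<close> is a bounded left inverse of \<open>I\<close>.  Let \<open>x\<close> have \<open>m\<close> entries
  \<open>\<pm>1\<close> and put \<open>l = 2 ln (1 / \<surd>m)\<close>.  The Taylor triple of \<open>extremal x\<close> is
  \<open>(l\<^sup>2x/2, l x, x)\<close>, of norm at most \<open>\<surd>m\<close>, although its entries contain the unbounded factor \<open>l\<close>.
  Since \<open>(0, (l\<^sup>2x/2, l x, x)) = I (l\<^sup>2x/2, l x) - l (x, 0) + (0, (0, 0, x))\<close>, the operator \<open>P\<close> is determined
  on this vector by its values at \<open>(x, 0)\<close> and \<open>(0, (0, 0, x))\<close>.  Test the second coordinate
  of \<open>P (0, (l\<^sup>2x/2, l x, x))\<close> against \<open>x\<close>, and \<open>P (x, 0)\<close> against \<open>(l x, x)\<close> in the pairing of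
  \<^const>\<open>Z2\<close> with itself (\<open>pairing_derivative\<close>).  Both results are \<open>O(m)\<close>, and their difference
  is \<open>l m\<close> plus a quadratic form in the signs.  Averaging over all signs leaves only the diagonal of the
  form, which is \<open>O(m)\<close> as well.  So \<open>ln m = -l\<close> would stay bounded as \<open>m\<close> grows.
\<close>

section \<open>Quotients of complete seminormed spaces\<close>

lemma scaleC_zero_right [simp]: "a *\<^sub>C (0::'a::complex_vector) = 0"
  using scaleC_add_right[of a "0::'a" 0] by simp

lemma scaleC_zero_left [simp]: "0 *\<^sub>C (x::'a::complex_vector) = 0"
  using scaleC_add_left[of 0 0 x] by simp

lemma scaleC_uminus_one: "(-1) *\<^sub>C (x::'a::complex_vector) = - x"
  using scaleC_add_left[of 1 "-1" x] by (simp add: scaleC_one eq_neg_iff_add_eq_0 add.commute)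

lemma csubspace_diff:
  assumes "csubspace V" "x \<in> V" "y \<in> V"
  shows "x - y \<in> V"
proof -
  have "x + (-1) *\<^sub>C y \<in> V"
    using assms unfolding csubspace_def by blast
  then show ?thesis by (simp add: scaleC_uminus_one)
qed

lemma csubspace_sum:
  assumes "csubspace V" "\<And>i. i \<in> A \<Longrightarrow> x i \<in> V"
  shows "sum x A \<in> V"
  using assms(2)
  by (induction A rule: infinite_finite_induct) (use assms(1) in \<open>auto simp: csubspace_def\<close>)

definition quotient_norm :: "'a set \<Rightarrow> ('a \<Rightarrow> real) \<Rightarrow> ('a \<Rightarrow> 'b) \<Rightarrow> 'b \<Rightarrow> real" where
  "quotient_norm V p T y = Inf (p ` {v \<in> V. T v = y})"

text \<open>\<^const>\<open>calF_norm\<close> ignores the values of a function off the closed strip, so it is only a seminorm on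
\<^const>\<open>calF\<close>.  For homogeneity the inequality suffices, since the scalar can be inverted.\<close>

locale complete_seminormed =
  fixes V :: "'a::complex_vector set" and p :: "'a \<Rightarrow> real"
  assumes subspace: "csubspace V"
    and nonneg: "v \<in> V \<Longrightarrow> 0 \<le> p v"
    and scale_le: "v \<in> V \<Longrightarrow> p (a *\<^sub>C v) \<le> cmod a * p v"
    and triangle: "v \<in> V \<Longrightarrow> w \<in> V \<Longrightarrow> p (v + w) \<le> p v + p w"
    and complete: "complete_on V p"

text \<open>The assumption \<open>separated\<close> says that the kernel of \<open>T\<close> is closed, in the form needed for
the quotient seminorm to be a norm.\<close>

locale quotient_map = complete_seminormed V p
  for V :: "'a::complex_vector set" and p :: "'a \<Rightarrow> real" +
  fixes T :: "'a \<Rightarrow> 'b::complex_vector"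
  assumes T_add: "v \<in> V \<Longrightarrow> w \<in> V \<Longrightarrow> T (v + w) = T v + T w"
    and T_scale: "v \<in> V \<Longrightarrow> T (a *\<^sub>C v) = a *\<^sub>C T v"
    and separated: "v \<in> V \<Longrightarrow> (\<And>e. e > 0 \<Longrightarrow> \<exists>w\<in>V. T w = T v \<and> p w < e) \<Longrightarrow> T v = 0"
begin

abbreviation "q \<equiv> quotient_norm V p T"

lemma in_add: "v \<in> V \<Longrightarrow> w \<in> V \<Longrightarrow> v + w \<in> V"
  and in_scale: "v \<in> V \<Longrightarrow> a *\<^sub>C v \<in> V"
  and in_zero: "0 \<in> V"
  and in_diff: "v \<in> V \<Longrightarrow> w \<in> V \<Longrightarrow> v - w \<in> V"
  using subspace csubspace_diff[OF subspace] unfolding csubspace_def by auto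

lemma T_zero: "T 0 = 0"
  using T_add[OF in_zero in_zero] by simp

lemma T_diff: "v \<in> V \<Longrightarrow> w \<in> V \<Longrightarrow> T (v - w) = T v - T w"
  using T_add[of "v - w" w] in_diff by (simp add: eq_diff_eq)

lemma bdd_below_lifts: "bdd_below (p ` {v \<in> V. T v = y})"
  using nonneg by (auto intro!: bdd_belowI[of _ 0])

lemma quotient_norm_le: "v \<in> V \<Longrightarrow> q (T v) \<le> p v"
  unfolding quotient_norm_def by (rule cInf_lower[OF _ bdd_below_lifts]) auto

lemma quotient_norm_greatest:
  assumes "y \<in> T ` V" "\<And>v. v \<in> V \<Longrightarrow> T v = y \<Longrightarrow> c \<le> p v"
  shows "c \<le> q y"
  unfolding quotient_norm_def by (rule cInf_greatest) (use assms in auto)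

lemma quotient_norm_lift:
  assumes "y \<in> T ` V" "q y < e"
  obtains v where "v \<in> V" "T v = y" "p v < e"
proof -
  have "p ` {v \<in> V. T v = y} \<noteq> {}" using assms(1) by auto
  from cInf_lessD[OF this assms(2)[unfolded quotient_norm_def]] that show ?thesis by auto
qed

lemma quotient_norm_nonneg: "y \<in> T ` V \<Longrightarrow> 0 \<le> q y"
  by (rule quotient_norm_greatest) (auto intro: nonneg)

lemma quotient_norm_triangle:
  assumes "x \<in> T ` V" "y \<in> T ` V"
  shows "q (x + y) \<le> q x + q y"
proof (rule field_le_epsilon)
  fix e :: real assume "e > 0"
  obtain v where v: "v \<in> V" "T v = x" "p v < q x + e / 2"
    using quotient_norm_lift[OF assms(1), of "q x + e / 2"] \<open>e > 0\<close> by auto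
  obtain w where w: "w \<in> V" "T w = y" "p w < q y + e / 2"
    using quotient_norm_lift[OF assms(2), of "q y + e / 2"] \<open>e > 0\<close> by auto
  have "q (x + y) \<le> p (v + w)"
    using quotient_norm_le[OF in_add[OF v(1) w(1)]] T_add v w by simp
  also have "\<dots> \<le> p v + p w" using triangle v w by simp
  finally show "q (x + y) \<le> q x + q y + e" using v w by simp
qed

lemma quotient_norm_scale_le:
  assumes "x \<in> T ` V"
  shows "q (a *\<^sub>C x) \<le> cmod a * q x"
proof (rule field_le_epsilon)
  fix e :: real assume "e > 0"
  have "e / (cmod a + 1) > 0"
    using \<open>e > 0\<close> by (simp add: add_nonneg_pos)
  then obtain v where v: "v \<in> V" "T v = x" "p v < q x + e / (cmod a + 1)"
    using quotient_norm_lift[OF assms, of "q x + e / (cmod a + 1)"] by auto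
  have "q (a *\<^sub>C x) \<le> p (a *\<^sub>C v)"
    using quotient_norm_le[OF in_scale[OF v(1)]] T_scale v by simp
  also have "\<dots> \<le> cmod a * p v" using scale_le v by simp
  also have "\<dots> \<le> cmod a * (q x + e / (cmod a + 1))"
    using v by (intro mult_left_mono) auto
  also have "\<dots> = cmod a * q x + cmod a * e / (cmod a + 1)" by (simp add: algebra_simps)
  also have "cmod a * e / (cmod a + 1) \<le> e"
    using \<open>e > 0\<close> add_nonneg_pos[of "cmod a" 1] by (simp add: divide_le_eq algebra_simps)
  finally show "q (a *\<^sub>C x) \<le> cmod a * q x + e" by simp
qed

lemma csubspace_image: "csubspace (T ` V)"
  unfolding csubspace_def
proof (intro conjI ballI allI)
  show "0 \<in> T ` V" using T_zero in_zero by force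
  show "x + y \<in> T ` V" if "x \<in> T ` V" "y \<in> T ` V" for x y
    using that T_add in_add by force
  show "a *\<^sub>C x \<in> T ` V" if x: "x \<in> T ` V" for a x
  proof -
    obtain v where "v \<in> V" "x = T v" using x by auto
    then have "a *\<^sub>C x = T (a *\<^sub>C v)" "a *\<^sub>C v \<in> V" by (auto simp: T_scale in_scale)
    then show ?thesis by blast
  qed
qed

lemma image_scale: "x \<in> T ` V \<Longrightarrow> a *\<^sub>C x \<in> T ` V"
  using csubspace_image unfolding csubspace_def by blast

lemma norm_on_quotient_norm: "norm_on (T ` V) q"
  unfolding norm_on_def
proof (intro conjI ballI allI)
  show "0 \<le> q x" if "x \<in> T ` V" for x using that by (rule quotient_norm_nonneg)
  show "q (x + y) \<le> q x + q y" if "x \<in> T ` V" "y \<in> T ` V" for x y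
    using that by (rule quotient_norm_triangle)
  have zero: "q 0 = 0"
    using quotient_norm_scale_le[of 0 0] csubspace_image quotient_norm_nonneg[of 0]
    by (simp add: csubspace_def)
  show "q x = 0 \<longleftrightarrow> x = 0" if x: "x \<in> T ` V" for x
  proof
    assume "q x = 0"
    obtain v where v: "v \<in> V" "x = T v" using x by auto
    show "x = 0" unfolding v(2)
    proof (rule separated[OF v(1)])
      fix e :: real assume "e > 0"
      then show "\<exists>w\<in>V. T w = T v \<and> p w < e"
        using quotient_norm_lift[OF x, of e] \<open>q x = 0\<close> v(2) by metis
    qed
  qed (simp add: zero)
  show "q (a *\<^sub>C x) = cmod a * q x" if x: "x \<in> T ` V" for a x
  proof (cases "a = 0")
    case False
    note ax = image_scale[OF x]
    have "q (inverse a *\<^sub>C a *\<^sub>C x) \<le> cmod (inverse a) * q (a *\<^sub>C x)"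
      by (rule quotient_norm_scale_le[OF ax])
    then have "cmod a * q x \<le> q (a *\<^sub>C x)"
      using False by (simp add: scaleC_scaleC scaleC_one norm_inverse norm_divide field_simps)
    then show ?thesis using quotient_norm_scale_le[OF x] by (simp add: antisym)
  qed (simp add: zero)
qed

text \<open>The classical lifting argument: along a rapidly convergent subsequence the successive differences
have lifts of summable seminorm, and the partial sums of these lifts converge upstairs.\<close>

lemma complete_on_quotient_norm: "complete_on (T ` V) q"
  unfolding complete_on_def
proof (intro allI impI, elim conjE)
  fix X :: "nat \<Rightarrow> 'b"
  assume X: "\<forall>n. X n \<in> T ` V"
    and "\<forall>e>0. \<exists>M. \<forall>m\<ge>M. \<forall>n\<ge>M. q (X m - X n) < e"
  then have "\<forall>i. \<exists>M. \<forall>m\<ge>M. \<forall>n\<ge>M. q (X m - X n) < (1/2) ^ i" by simp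
  then obtain M where M: "\<And>i m n. m \<ge> M i \<Longrightarrow> n \<ge> M i \<Longrightarrow> q (X m - X n) < (1/2) ^ i"
    by metis
  \<comment> \<open>Summing makes the chosen indices increasing.\<close>
  define r where "r i = (\<Sum>j\<le>i. M j)" for i :: nat
  have rM: "M i \<le> r i" for i unfolding r_def by (rule member_le_sum) auto
  have r_Suc: "r i \<le> r (Suc i)" for i unfolding r_def by simp
  have XV: "X m - X n \<in> T ` V" for m n
    using X csubspace_diff[OF csubspace_image] by blast
  have "\<exists>v\<in>V. T v = X (r (Suc i)) - X (r i) \<and> p v < (1/2) ^ i" for i
  proof (rule quotient_norm_lift[OF XV])
    show "q (X (r (Suc i)) - X (r i)) < (1/2) ^ i"
      using rM[of i] r_Suc[of i] by (intro M) auto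
  qed auto
  then obtain d where d: "\<And>i. d i \<in> V" "\<And>i. T (d i) = X (r (Suc i)) - X (r i)"
      "\<And>i. p (d i) < (1/2) ^ i"
    by metis
  obtain v where v: "v \<in> V" "T v = X (r 0)" using X by (metis imageE)
  define S where "S n = v + (\<Sum>i<n. d i)" for n
  have S: "S n \<in> V" for n
    unfolding S_def using v d by (intro in_add csubspace_sum[OF subspace]) auto
  have TS: "T (S n) = X (r n)" for n
  proof (induction n)
    case (Suc n)
    have "T (S (Suc n)) = T (S n + d n)" by (simp add: S_def add.assoc)
    also have "\<dots> = X (r (Suc n))" using Suc T_add[OF S d(1)] d(2) by simp
    finally show ?case .
  qed (simp add: S_def v)
  have tail: "p (S (n + k) - S n) \<le> 2 * (1/2) ^ n - 2 * (1/2) ^ (n + k)" for n k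
  proof (induction k)
    case 0
    show ?case using scale_le[OF in_zero, of 0] by simp
  next
    case (Suc k)
    have "p (S (n + Suc k) - S n) = p ((S (n + k) - S n) + d (n + k))"
      by (simp add: S_def algebra_simps)
    also have "\<dots> \<le> p (S (n + k) - S n) + p (d (n + k))"
      by (intro triangle in_diff S d)
    also have "\<dots> \<le> (2 * (1/2) ^ n - 2 * (1/2) ^ (n + k)) + (1/2) ^ (n + k)"
      using Suc d(3)[of "n + k"] by simp
    finally show ?case by simp
  qed
  have flip: "p (x - y) \<le> p (y - x)" if "x \<in> V" "y \<in> V" for x y
    using scale_le[OF in_diff[OF that(2) that(1)], of "-1"] by (simp add: scaleC_uminus_one)
  have small: "p (S m - S n) \<le> 4 * (1/2) ^ i" if "m \<ge> i" "n \<ge> i" for m n i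
  proof -
    have 1: "p (S j - S i) \<le> 2 * (1/2) ^ i" if "j \<ge> i" for j
      using tail[of i "j - i"] that by (simp add: order_trans)
    have "p (S m - S n) = p ((S m - S i) + (S i - S n))" by simp
    also have "\<dots> \<le> p (S m - S i) + p (S i - S n)" by (intro triangle in_diff S)
    also have "p (S i - S n) \<le> p (S n - S i)" by (intro flip S)
    finally show ?thesis using 1[OF that(1)] 1[OF that(2)] by simp
  qed
  have pow: "\<exists>i. (1/2::real) ^ i < e" if "e > 0" for e
    using real_arch_pow_inv[OF that, of "1/2"] by auto
  have "\<forall>e>0. \<exists>M. \<forall>m\<ge>M. \<forall>n\<ge>M. p (S m - S n) < e"
  proof (intro allI impI)
    fix e :: real assume "e > 0"
    then obtain i where i: "(1/2::real) ^ i < e / 4" using pow[of "e / 4"] by auto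
    show "\<exists>M. \<forall>m\<ge>M. \<forall>n\<ge>M. p (S m - S n) < e"
    proof (intro exI[of _ i] allI impI)
      fix m n assume "m \<ge> i" "n \<ge> i"
      then have "p (S m - S n) \<le> 4 * (1/2) ^ i" by (rule small)
      then show "p (S m - S n) < e" using i by simp
    qed
  qed
  then obtain s where s: "s \<in> V" "(\<lambda>n. p (S n - s)) \<longlonglongrightarrow> 0"
    using complete S unfolding complete_on_def by metis
  have "(\<lambda>n. q (X n - T s)) \<longlonglongrightarrow> 0"
  proof (rule LIMSEQ_I)
    fix e :: real assume "e > 0"
    then obtain j where j: "(1/2::real) ^ j < e / 2" using pow[of "e / 2"] by auto
    obtain k where k: "\<And>n. n \<ge> k \<Longrightarrow> norm (p (S n - s) - 0) < e / 2"
      using LIMSEQ_D[OF s(2), of "e / 2"] \<open>e > 0\<close> by auto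
    define i where "i = max j k"
    have "(1/2::real) ^ i \<le> (1/2) ^ j" unfolding i_def by (intro power_decreasing) auto
    show "\<exists>no. \<forall>n\<ge>no. norm (q (X n - T s) - 0) < e"
    proof (intro exI[of _ "r i"] allI impI)
      fix n assume "n \<ge> r i"
      have "X n - T s = (X n - X (r i)) + T (S i - s)"
        using TS T_diff[OF S s(1)] by simp
      then have "q (X n - T s) = q ((X n - X (r i)) + T (S i - s))" by (rule arg_cong)
      also have "\<dots> \<le> q (X n - X (r i)) + q (T (S i - s))"
        using in_diff[OF S s(1)] by (intro quotient_norm_triangle XV) auto
      finally have "q (X n - T s) \<le> q (X n - X (r i)) + q (T (S i - s))" .
      moreover have "q (X n - X (r i)) < (1/2) ^ i"
        using \<open>n \<ge> r i\<close> rM[of i] by (intro M) auto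
      moreover have "q (T (S i - s)) \<le> p (S i - s)"
        by (intro quotient_norm_le in_diff S s)
      moreover have "p (S i - s) < e / 2" using k[of i] by (simp add: i_def)
      moreover have "0 \<le> q (X n - T s)"
        using X s(1) by (intro quotient_norm_nonneg csubspace_diff[OF csubspace_image]) auto
      ultimately show "norm (q (X n - T s) - 0) < e"
        using j \<open>(1/2::real) ^ i \<le> (1/2) ^ j\<close> unfolding real_norm_def by linarith
    qed
  qed
  then show "\<exists>x\<in>T ` V. (\<lambda>n. q (X n - x)) \<longlonglongrightarrow> 0" using s(1) by auto
qed

theorem banach_on_quotient: "banach_on (T ` V) q"
  unfolding banach_on_def
  using csubspace_image norm_on_quotient_norm complete_on_quotient_norm by blast

end

lemma banach_on_cong:
  assumes "banach_on V N" "\<And>x. x \<in> V \<Longrightarrow> N x = N' x"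
  shows "banach_on V N'"
proof -
  have V: "csubspace V" using assms(1) by (simp add: banach_on_def)
  have "norm_on V N'"
    unfolding norm_on_def
  proof (intro conjI ballI allI)
    fix x assume x: "x \<in> V"
    have N: "norm_on V N" using assms(1) by (simp add: banach_on_def)
    have [simp]: "N' x = N x" using assms(2) x by simp
    show "0 \<le> N' x" "N' x = 0 \<longleftrightarrow> x = 0" using N x by (auto simp: norm_on_def)
    have "a *\<^sub>C x \<in> V" for a using V x by (simp add: csubspace_def)
    then have "N' (a *\<^sub>C x) = N (a *\<^sub>C x)" for a using assms(2) by simp
    then show "N' (a *\<^sub>C x) = cmod a * N' x" for a using N x by (simp add: norm_on_def)
    fix y assume y: "y \<in> V"
    have "x + y \<in> V" using V x y by (simp add: csubspace_def)
    then have "N' (x + y) = N (x + y)" "N' y = N y" using assms(2) y by auto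
    then show "N' (x + y) \<le> N' x + N' y" using N x y by (simp add: norm_on_def)
  qed
  moreover have "complete_on V N'"
    unfolding complete_on_def
  proof (intro allI impI, elim conjE)
    fix X :: "nat \<Rightarrow> 'a"
    assume X: "\<forall>n. X n \<in> V" and c: "\<forall>e>0. \<exists>M. \<forall>m\<ge>M. \<forall>n\<ge>M. N' (X m - X n) < e"
    have "N (X m - X n) = N' (X m - X n)" for m n
      using X assms(2) csubspace_diff[OF V] by blast
    then obtain x where "x \<in> V" "(\<lambda>n. N (X n - x)) \<longlonglongrightarrow> 0"
      using assms(1) X c unfolding banach_on_def complete_on_def by metis
    moreover have "N (X n - x) = N' (X n - x)" for n
      using X assms(2) csubspace_diff[OF V] \<open>x \<in> V\<close> by blast
    ultimately show "\<exists>x\<in>V. (\<lambda>n. N' (X n - x)) \<longlonglongrightarrow> 0" by auto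
  qed
  ultimately show ?thesis using V by (simp add: banach_on_def)
qed

lemma banach_on_Times:
  assumes "banach_on V M" "banach_on W N"
  shows "banach_on (V \<times> W) (sum_norm M N)"
proof -
  note V = assms(1)[unfolded banach_on_def] and W = assms(2)[unfolded banach_on_def]
  have sub: "csubspace (V \<times> W)"
    using V W by (auto simp: csubspace_def scaleC_prod_def zero_prod_def)
  have "norm_on (V \<times> W) (sum_norm M N)"
    unfolding norm_on_def
  proof (intro conjI ballI allI)
    fix x assume x: "x \<in> V \<times> W"
    show "0 \<le> sum_norm M N x"
      using x V W by (auto simp: sum_norm_def norm_on_def)
    have "0 \<le> M (fst x)" "0 \<le> N (snd x)" using x V W by (auto simp: norm_on_def)
    moreover have "M (fst x) = 0 \<longleftrightarrow> fst x = 0" "N (snd x) = 0 \<longleftrightarrow> snd x = 0"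
      using x V W by (auto simp: norm_on_def)
    ultimately show "sum_norm M N x = 0 \<longleftrightarrow> x = 0"
      by (auto simp: sum_norm_def prod_eq_iff case_prod_beta add_nonneg_eq_0_iff)
    show "sum_norm M N (a *\<^sub>C x) = cmod a * sum_norm M N x" for a
      using x V W by (auto simp: sum_norm_def norm_on_def scaleC_prod_def algebra_simps)
    fix y assume y: "y \<in> V \<times> W"
    have "M (fst x + fst y) \<le> M (fst x) + M (fst y)" "N (snd x + snd y) \<le> N (snd x) + N (snd y)"
      using x y V W by (auto simp: norm_on_def)
    then show "sum_norm M N (x + y) \<le> sum_norm M N x + sum_norm M N y"
      by (simp add: sum_norm_def case_prod_beta)
  qed
  moreover have "complete_on (V \<times> W) (sum_norm M N)"
    unfolding complete_on_def
  proof (intro allI impI, elim conjE)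
    fix X :: "nat \<Rightarrow> 'a \<times> 'b"
    assume X: "\<forall>n. X n \<in> V \<times> W"
      and c: "\<forall>e>0. \<exists>K. \<forall>m\<ge>K. \<forall>n\<ge>K. sum_norm M N (X m - X n) < e"
    have X1: "fst (X n) \<in> V" and X2: "snd (X n) \<in> W" for n using X by (auto simp: mem_Times_iff)
    have nn: "0 \<le> M (fst (X m) - fst (X n))" "0 \<le> N (snd (X m) - snd (X n))" for m n
      using V W X1 X2 csubspace_diff[of V] csubspace_diff[of W] by (auto simp: norm_on_def)
    have le: "M (fst (X m) - fst (X n)) \<le> sum_norm M N (X m - X n)"
        "N (snd (X m) - snd (X n)) \<le> sum_norm M N (X m - X n)" for m n
      using nn[of m n] by (simp_all add: sum_norm_def case_prod_beta)
    have "\<forall>e>0. \<exists>K. \<forall>m\<ge>K. \<forall>n\<ge>K. M (fst (X m) - fst (X n)) < e"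
      using c le(1) le_less_trans by meson
    then obtain x where x: "x \<in> V" "(\<lambda>n. M (fst (X n) - x)) \<longlonglongrightarrow> 0"
      using V X1 unfolding complete_on_def by (elim conjE allE[of _ "\<lambda>n. fst (X n)"]) auto
    have "\<forall>e>0. \<exists>K. \<forall>m\<ge>K. \<forall>n\<ge>K. N (snd (X m) - snd (X n)) < e"
      using c le(2) le_less_trans by meson
    then obtain y where y: "y \<in> W" "(\<lambda>n. N (snd (X n) - y)) \<longlonglongrightarrow> 0"
      using W X2 unfolding complete_on_def by (elim conjE allE[of _ "\<lambda>n. snd (X n)"]) auto
    note x y
    then show "\<exists>x\<in>V \<times> W. (\<lambda>n. sum_norm M N (X n - x)) \<longlonglongrightarrow> 0"
      using tendsto_add[of "\<lambda>n. M (fst (X n) - x)" 0 _ "\<lambda>n. N (snd (X n) - y)" 0]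
      by (intro bexI[of _ "(x, y)"]) (auto simp: sum_norm_def case_prod_beta)
  qed
  ultimately show ?thesis using sub by (simp add: banach_on_def)
qed

section \<open>Holomorphic functions on the strip\<close>

lemma open_strip: "open strip"
proof -
  have "strip = {z. 0 < Re z} \<inter> {z. Re z < 1}" by (auto simp: strip_def)
  then show ?thesis using open_Int[OF open_halfspace_Re_gt[of 0] open_halfspace_Re_lt[of 1]] by argo
qed

lemma strip_subset: "strip \<subseteq> closed_strip"
  by (auto simp: strip_def closed_strip_def)

lemma half_in_strip: "1 / 2 \<in> strip"
  by (simp add: strip_def)

lemma closed_strip_cases:
  assumes "z \<in> closed_strip"
  obtains "z \<in> strip" | t where "z = \<i> * of_real t" | t where "z = 1 + \<i> * of_real t"
proof -
  have "z = \<i> * of_real (Im z)" if "Re z = 0" using that by (simp add: complex_eq_iff)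
  moreover have "z = 1 + \<i> * of_real (Im z)" if "Re z = 1" using that by (simp add: complex_eq_iff)
  moreover have "z \<in> strip \<or> Re z = 0 \<or> Re z = 1"
    using assms by (auto simp: strip_def closed_strip_def)
  ultimately show ?thesis using that by blast
qed

lemma boundary_in_closed_strip:
  "\<i> * of_real t \<in> closed_strip" "1 + \<i> * of_real t \<in> closed_strip"
  by (auto simp: closed_strip_def)

text \<open>The maximum principle of Phragmen and Lindeloef.  The strip is unbounded, so \<open>f\<close> is first damped by
\<open>exp (e (z\<^sup>2 - 1))\<close>.  This factor has modulus at most \<open>1\<close> on the closed strip and decays as
\<open>\<bar>Im z\<bar>\<close> grows, so the maximum principle on a tall rectangle applies.  Then \<open>e\<close> tends to \<open>0\<close>.\<close>

lemma strip_maximum_modulus: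
  assumes hol: "f holomorphic_on strip" and cont: "continuous_on closed_strip f"
    and bounded: "\<And>w. w \<in> closed_strip \<Longrightarrow> cmod (f w) \<le> M"
    and left: "\<And>t::real. cmod (f (\<i> * of_real t)) \<le> B"
    and right: "\<And>t::real. cmod (f (1 + \<i> * of_real t)) \<le> B"
    and z: "z \<in> closed_strip"
  shows "cmod (f z) \<le> B"
proof -
  have B: "0 \<le> B" using left[of 0] norm_ge_zero order_trans by blast
  have M: "0 \<le> M" using bounded[OF z] norm_ge_zero order_trans by blast
  have damped: "cmod (exp (of_real e * (z\<^sup>2 - 1)) * f z) \<le> B + e" if e: "e > 0" for e :: real
  proof -
    define g where "g w = exp (of_real e * (w\<^sup>2 - 1)) * f w" for w
    \<comment> \<open>High enough for the damped function to be at most \<open>e\<close> on the horizontal sides.\<close>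
    define R where "R = \<bar>Im z\<bar> + sqrt (M / e\<^sup>2)"
    have R0: "R \<ge> 0" using M e by (simp add: R_def)
    have "M / e\<^sup>2 = (sqrt (M / e\<^sup>2))\<^sup>2" using M by simp
    also have "\<dots> \<le> R\<^sup>2" unfolding R_def using M by (intro power_mono) auto
    finally have "M / e \<le> e * R\<^sup>2" using e by (simp add: field_simps power2_eq_square)
    also have "\<dots> \<le> exp (e * R\<^sup>2)" using exp_ge_add_one_self[of "e * R\<^sup>2"] by linarith
    finally have decay: "exp (- (e * R\<^sup>2)) * M \<le> e"
      using e by (simp add: exp_minus field_simps)
    have gle: "cmod (g w) \<le> exp (- (e * (Im w)\<^sup>2)) * cmod (f w)" if "w \<in> closed_strip" for w
    proof -
      have "(Re w)\<^sup>2 \<le> 1" using that by (simp add: closed_strip_def power_le_one)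
      then have "e * ((Re w)\<^sup>2 - (Im w)\<^sup>2 - 1) \<le> e * (- (Im w)\<^sup>2)"
        using e by (intro mult_left_mono) auto
      then have "exp (Re (of_real e * (w\<^sup>2 - 1))) \<le> exp (- (e * (Im w)\<^sup>2))"
        by (simp add: power2_eq_square algebra_simps)
      then show ?thesis unfolding g_def norm_mult norm_exp_eq_Re by (rule mult_right_mono) auto
    qed
    let ?S = "cbox (Complex 0 (-R)) (Complex 1 R)"
    have sub: "?S \<subseteq> closed_strip" by (auto simp: in_cbox_complex_iff closed_strip_def)
    have int: "interior ?S \<subseteq> strip"
      by (auto simp: interior_cbox in_box_complex_iff strip_def)
    have "cmod (g z) \<le> B + e"
    proof (rule maximum_modulus_frontier[where f = g and S = ?S])
      show "g holomorphic_on interior ?S"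
        unfolding g_def
        by (intro holomorphic_on_mult holomorphic_on_subset[OF hol int] holomorphic_intros)
      show "continuous_on (closure ?S) g"
        unfolding g_def using sub
        by (intro continuous_intros continuous_on_subset[OF cont]) auto
      have "\<bar>Im z\<bar> \<le> R" using M by (simp add: R_def)
      then show "z \<in> ?S" using z by (auto simp: in_cbox_complex_iff closed_strip_def)
      fix w assume "w \<in> frontier ?S"
      then have w: "w \<in> ?S" "w \<notin> interior ?S" by (auto simp: frontier_def)
      then have wc: "w \<in> closed_strip" using sub by auto
      have ex1: "exp (- (e * (Im w)\<^sup>2)) \<le> 1" using e by simp
      consider "Re w = 0" | "Re w = 1" | "\<bar>Im w\<bar> = R"
        using w by (force simp: interior_cbox in_box_complex_iff in_cbox_complex_iff)
      then show "cmod (g w) \<le> B + e"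
      proof cases
        case 1
        then have "w = \<i> * of_real (Im w)" by (simp add: complex_eq_iff)
        then have fw: "cmod (f w) \<le> B" using left by metis
        show ?thesis using gle[OF wc] mult_mono[OF ex1 fw] B e by simp
      next
        case 2
        then have "w = 1 + \<i> * of_real (Im w)" by (simp add: complex_eq_iff)
        then have fw: "cmod (f w) \<le> B" using right by metis
        show ?thesis using gle[OF wc] mult_mono[OF ex1 fw] B e by simp
      next
        case 3
        then have "(Im w)\<^sup>2 = R\<^sup>2" by (metis power2_abs)
        then have "cmod (g w) \<le> exp (- (e * R\<^sup>2)) * M"
          using gle[OF wc] mult_left_mono[OF bounded[OF wc] exp_ge_zero[of "- (e * R\<^sup>2)"]]
          by (metis order_trans)
        then show ?thesis using decay B by simp
      qed
    qed (use bounded_cbox in auto)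
    then show ?thesis by (simp add: g_def)
  qed
  have "((\<lambda>e. cmod (exp (of_real e * (z\<^sup>2 - 1)) * f z)) \<longlongrightarrow>
      cmod (exp (of_real 0 * (z\<^sup>2 - 1)) * f z)) (at_right 0)"
    by (intro tendsto_intros)
  moreover have "((\<lambda>e. B + e) \<longlongrightarrow> B + 0) (at_right 0)" by (intro tendsto_intros)
  moreover have "\<forall>\<^sub>F e in at_right 0. cmod (exp (of_real e * (z\<^sup>2 - 1)) * f z) \<le> B + e"
    using eventually_at_right_less by (rule eventually_mono) (rule damped)
  ultimately have "cmod (exp (of_real 0 * (z\<^sup>2 - 1)) * f z) \<le> B + 0"
    by (intro tendsto_le[OF trivial_limit_at_right_real])
  then show ?thesis by simp
qed

text \<open>Cauchy's estimate with a constant that depends on \<open>M\<close>, \<open>r\<close> and \<open>n\<close> alone, hence uniform over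
the coordinates of a bounded vector-valued function.\<close>

lemma higher_deriv_bound:
  assumes "f holomorphic_on ball z r" "\<And>w. w \<in> ball z r \<Longrightarrow> cmod (f w) \<le> M"
    and "r > 0" "w \<in> ball z (r / 2)"
  shows "cmod ((deriv ^^ n) f w) \<le> fact n * M / (r / 4) ^ n"
proof -
  have sub: "cball w (r / 4) \<subseteq> ball z r"
  proof
    fix x assume "x \<in> cball w (r / 4)"
    then show "x \<in> ball z r"
      using assms(3,4) dist_triangle[of z x w] by (simp add: dist_commute)
  qed
  show ?thesis
  proof (rule Cauchy_inequality)
    show "f holomorphic_on ball w (r / 4)"
      using sub ball_subset_cball by (intro holomorphic_on_subset[OF assms(1)]) blast
    show "continuous_on (cball w (r / 4)) f"
      using holomorphic_on_imp_continuous_on[OF assms(1)] sub by (rule continuous_on_subset)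
    show "cmod (f x) \<le> M" if "cmod (w - x) = r / 4" for x
      using that sub by (intro assms(2)) (auto simp: dist_norm)
  qed (use assms in auto)
qed

section \<open>Vector-valued derivatives are coordinatewise derivatives\<close>

lemma linf_iff: "x \<in> linf \<longleftrightarrow> (\<exists>B. \<forall>k. cmod (x k) \<le> B)"
  unfolding linf_def bounded_iff by auto

lemma linf_norm_le: "(\<And>k. cmod (x k) \<le> B) \<Longrightarrow> linf_norm x \<le> B"
  unfolding linf_norm_def by (rule cSUP_least) auto

lemma coordinate_le_linf_norm: "x \<in> linf \<Longrightarrow> cmod (x k) \<le> linf_norm x"
  unfolding linf_norm_def by (rule cSUP_upper) (auto simp: linf_iff bdd_above_def)

lemma linf_add: "x \<in> linf \<Longrightarrow> y \<in> linf \<Longrightarrow> x + y \<in> linf"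
  unfolding linf_iff plus_fun_def by (metis add_mono norm_triangle_le)

lemma linf_scale: "x \<in> linf \<Longrightarrow> a *\<^sub>C x \<in> linf"
  unfolding linf_iff scaleC_fun_def scaleC_complex_def
  by (metis mult_left_mono norm_ge_zero norm_mult)

lemma csubspace_linf: "csubspace linf"
  using linf_add linf_scale by (auto simp: csubspace_def linf_iff[of 0])

lemma scaleC_apply [simp]: "(a *\<^sub>C f) k = a *\<^sub>C f k"
  by (simp add: scaleC_fun_def)

declare scaleC_complex_def [simp]

lemma has_linf_derivative_coordinate:
  assumes "has_linf_derivative F D z" "open S" "z \<in> S" "\<And>w. w \<in> S \<Longrightarrow> F w \<in> linf"
  shows "((\<lambda>w. F w k) has_field_derivative D k) (at z)"
proof -
  have D: "D \<in> linf" and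
    lim: "((\<lambda>w. linf_norm (inverse (w - z) *\<^sub>C (F w - F z) - D)) \<longlongrightarrow> 0) (at z)"
    using assms(1) by (auto simp: has_linf_derivative_def)
  have "((\<lambda>w. (F w k - F z k) / (w - z) - D k) \<longlongrightarrow> 0) (at z)"
  proof (rule Lim_null_comparison[OF _ lim])
    have "\<forall>\<^sub>F w in at z. w \<in> S" using assms(2,3) by (rule eventually_at_in_open')
    then show "\<forall>\<^sub>F w in at z. cmod ((F w k - F z k) / (w - z) - D k)
        \<le> linf_norm (inverse (w - z) *\<^sub>C (F w - F z) - D)"
    proof (rule eventually_mono)
      fix w assume "w \<in> S"
      then have "inverse (w - z) *\<^sub>C (F w - F z) - D \<in> linf"
        by (intro csubspace_diff[OF csubspace_linf] linf_scale assms(4) D assms(3))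
      from coordinate_le_linf_norm[OF this, of k]
      show "cmod ((F w k - F z k) / (w - z) - D k)
        \<le> linf_norm (inverse (w - z) *\<^sub>C (F w - F z) - D)"
        by (simp add: divide_inverse mult.commute)
    qed
  qed
  then show ?thesis unfolding has_field_derivative_iff by (rule LIM_zero_cancel)
qed

text \<open>The error of the difference quotient in each coordinate is controlled by the second derivative, and
Cauchy's estimate bounds that one uniformly in the coordinate.  So the convergence is uniform in \<open>k\<close>,
that is, it holds in the sup norm.\<close>

lemma has_linf_derivative_if_coordinates_bounded:
  assumes hol: "\<And>k. (\<lambda>w. F w k) holomorphic_on ball z r"
    and bound: "\<And>w k. w \<in> ball z r \<Longrightarrow> cmod (F w k) \<le> M"
    and r: "r > 0"
  shows "has_linf_derivative F (\<lambda>k. deriv (\<lambda>w. F w k) z) z"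
proof -
  define D where "D k = deriv (\<lambda>w. F w k) z" for k
  define C where "C = 2 * M / (r / 4)\<^sup>2"
  have bd: "cmod ((deriv ^^ n) (\<lambda>w. F w k) w) \<le> fact n * M / (r / 4) ^ n"
    if "w \<in> ball z (r / 2)" for n k w
    using hol bound r that by (rule higher_deriv_bound)
  have "D \<in> linf"
    unfolding linf_iff D_def using bd[of z 1] r by auto
  have factor: "cmod (inverse h * a) \<le> C * cmod h" if "cmod a \<le> C * cmod h ^ 2" "h \<noteq> 0" for a h
    using that by (simp add: norm_divide divide_inverse[symmetric] mult.commute[of "inverse h"]
        divide_le_eq power2_eq_square mult.assoc)
  have quot: "cmod (inverse (w - z) * (F w k - F z k) - D k) \<le> C * cmod (w - z)"
    if w: "w \<in> ball z (r / 2)" "w \<noteq> z" for w k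
  proof -
    let ?f = "\<lambda>w. F w k"
    have "cmod ((deriv ^^ 0) ?f w - (\<Sum>i\<le>1. (deriv ^^ i) ?f z * (w - z) ^ i / fact i))
        \<le> C * cmod (w - z) ^ Suc 1 / fact 1"
    proof (rule complex_Taylor[where S = "ball z (r / 2)"])
      fix i x assume x: "x \<in> ball z (r / 2)"
      then have "x \<in> ball z r" using r by auto
      then show "((deriv ^^ i) ?f has_field_derivative (deriv ^^ Suc i) ?f x) (at x within ball z (r / 2))"
        by (rule has_field_derivative_at_within[OF has_field_derivative_higher_deriv[OF hol open_ball]])
      show "cmod ((deriv ^^ Suc 1) ?f x) \<le> C"
        using bd[OF x, where n = 2] by (simp add: C_def numeral_2_eq_2)
    qed (use w r in auto)
    then have "cmod (F w k - (F z k + D k * (w - z))) \<le> C * cmod (w - z) ^ 2"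
      by (simp add: D_def numeral_2_eq_2)
    moreover have "inverse (w - z) * (F w k - F z k) - D k
        = inverse (w - z) * (F w k - (F z k + D k * (w - z)))"
      using w by (simp add: field_simps)
    ultimately show ?thesis
      using w factor by simp
  qed
  have "((\<lambda>w. linf_norm (inverse (w - z) *\<^sub>C (F w - F z) - D)) \<longlongrightarrow> 0) (at z)"
  proof (rule Lim_null_comparison)
    have "\<forall>\<^sub>F w in at z. w \<in> ball z (r / 2) - {z}"
      using r by (intro eventually_at_in_open) auto
    then show "\<forall>\<^sub>F w in at z. norm (linf_norm (inverse (w - z) *\<^sub>C (F w - F z) - D)) \<le> C * cmod (w - z)"
    proof (rule eventually_mono)
      fix w assume w: "w \<in> ball z (r / 2) - {z}"
      let ?x = "inverse (w - z) *\<^sub>C (F w - F z) - D"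
      have x: "cmod (?x k) \<le> C * cmod (w - z)" for k using quot[of w k] w by simp
      then have "linf_norm ?x \<le> C * cmod (w - z)" by (rule linf_norm_le)
      moreover have "?x \<in> linf" unfolding linf_iff using x by blast
      then have "0 \<le> linf_norm ?x" using coordinate_le_linf_norm norm_ge_zero order_trans by blast
      ultimately show "norm (linf_norm ?x) \<le> C * cmod (w - z)" by simp
    qed
    have "((\<lambda>w. C * cmod (w - z)) \<longlongrightarrow> C * cmod (z - z)) (at z)" by (intro tendsto_intros)
    then show "((\<lambda>w. C * cmod (w - z)) \<longlongrightarrow> 0) (at z)" by simp
  qed
  then show ?thesis using \<open>D \<in> linf\<close> unfolding has_linf_derivative_def D_def by blast
qed

lemma has_linf_derivative_transform:
  assumes "has_linf_derivative F D z" "open S" "z \<in> S" "\<And>w. w \<in> S \<Longrightarrow> F w = G w"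
  shows "has_linf_derivative G D z"
proof -
  have "\<forall>\<^sub>F w in at z. w \<in> S" using assms(2,3) by (rule eventually_at_in_open')
  then have "\<forall>\<^sub>F w in at z. linf_norm (inverse (w - z) *\<^sub>C (F w - F z) - D)
      = linf_norm (inverse (w - z) *\<^sub>C (G w - G z) - D)"
    by (rule eventually_mono) (use assms in simp)
  from tendsto_cong[OF this] show ?thesis
    using assms(1) unfolding has_linf_derivative_def by blast
qed

lemma linf_deriv_eqI:
  assumes "has_linf_derivative F D z" "open S" "z \<in> S" "\<And>w. w \<in> S \<Longrightarrow> F w \<in> linf"
  shows "linf_deriv F z = D"
  unfolding linf_deriv_def
proof (rule the_equality, rule assms(1))
  fix D' assume D': "has_linf_derivative F D' z"
  show "D' = D"
    using DERIV_unique has_linf_derivative_coordinate[OF D' assms(2-4)]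
      has_linf_derivative_coordinate[OF assms] by (intro ext) blast
qed

text \<open>The derivatives are only locally bounded, so each step of the induction works on a smaller ball.\<close>

lemma higher_linf_deriv_eq:
  assumes S: "open S" and hol: "\<And>k. (\<lambda>w. F w k) holomorphic_on S"
    and bound: "\<And>w k. w \<in> S \<Longrightarrow> cmod (F w k) \<le> M"
  shows "z \<in> S \<Longrightarrow> (linf_deriv ^^ i) F z = (\<lambda>k. (deriv ^^ i) (\<lambda>w. F w k) z)"
proof (induction i arbitrary: z)
  case (Suc i)
  obtain r where r: "r > 0" "ball z r \<subseteq> S" using S Suc.prems openE by blast
  have "ball z (r / 2) \<subseteq> ball z r" using r by (intro subset_ball) simp
  then have r2: "ball z (r / 2) \<subseteq> S" using r(2) by (rule order_trans)
  let ?G = "\<lambda>w k. (deriv ^^ i) (\<lambda>w. F w k) w"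
  have hol': "(\<lambda>w. F w k) holomorphic_on ball z r" for k
    using hol r(2) by (rule holomorphic_on_subset)
  have bound': "cmod (?G w k) \<le> fact i * M / (r / 4) ^ i" if "w \<in> ball z (r / 2)" for w k
    using hol' bound r that by (intro higher_deriv_bound) auto
  have "has_linf_derivative ?G (\<lambda>k. deriv (\<lambda>w. ?G w k) z) z"
  proof (rule has_linf_derivative_if_coordinates_bounded)
    show "(\<lambda>w. ?G w k) holomorphic_on ball z (r / 2)" for k
      using holomorphic_on_subset[OF holomorphic_higher_deriv[OF hol S] r2] by simp
  qed (use bound' r in auto)
  note deriv_G = this
  have eq: "(linf_deriv ^^ i) F w = ?G w" if "w \<in> ball z (r / 2)" for w
    using Suc.IH that r2 by blast
  from deriv_G have "has_linf_derivative ((linf_deriv ^^ i) F) (\<lambda>k. deriv (\<lambda>w. ?G w k) z) z"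
    by (rule has_linf_derivative_transform[OF _ open_ball[of z "r / 2"]]) (use r eq in auto)
  then have "linf_deriv ((linf_deriv ^^ i) F) z = (\<lambda>k. deriv (\<lambda>w. ?G w k) z)"
  proof (rule linf_deriv_eqI[OF _ open_ball])
    show "z \<in> ball z (r / 2)" using r by simp
    show "(linf_deriv ^^ i) F w \<in> linf" if "w \<in> ball z (r / 2)" for w
      unfolding eq[OF that] linf_iff using bound'[OF that] by blast
  qed
  then show ?case by simp
qed simp

section \<open>The space of analytic functions\<close>

lemma l1_iff: "x \<in> l1 \<and> l1_norm x \<le> B \<longleftrightarrow> (\<forall>n. (\<Sum>k<n. cmod (x k)) \<le> B)"
proof
  assume x: "x \<in> l1 \<and> l1_norm x \<le> B"
  have "(\<Sum>k<n. cmod (x k)) \<le> l1_norm x" for n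
    unfolding l1_norm_def using x by (intro sum_le_suminf) (auto simp: l1_def)
  then show "\<forall>n. (\<Sum>k<n. cmod (x k)) \<le> B"
    using x by (meson order_trans)
next
  assume *: "\<forall>n. (\<Sum>k<n. cmod (x k)) \<le> B"
  then have "summable (\<lambda>k. cmod (x k))" by (intro summableI_nonneg_bounded) auto
  then show "x \<in> l1 \<and> l1_norm x \<le> B"
    using * by (auto simp: l1_def l1_norm_def intro: suminf_le_const)
qed

lemma coordinate_le_partial_sums:
  fixes x :: cseq
  assumes "\<And>n. (\<Sum>k<n. cmod (x k)) \<le> B"
  shows "cmod (x k) \<le> B"
proof -
  have "cmod (x k) \<le> (\<Sum>k<Suc k. cmod (x k))" by (simp add: sum_nonneg)
  also have "\<dots> \<le> B" by (rule assms)
  finally show ?thesis .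
qed

text \<open>For a bounded function, the series that defines a pairing with \<^const>\<open>l1\<close> converges uniformly.\<close>

lemma weak_star_continuous_onI:
  assumes cont: "\<And>k. continuous_on S (\<lambda>z. F z k)"
    and bound: "\<And>z k. z \<in> S \<Longrightarrow> cmod (F z k) \<le> M"
  shows "weak_star_continuous_on S F"
  unfolding weak_star_continuous_on_def
proof
  fix a assume a: "a \<in> l1"
  have "uniform_limit S (\<lambda>n z. \<Sum>k<n. F z k * a k) (\<lambda>z. \<Sum>k. F z k * a k) sequentially"
  proof (rule Weierstrass_m_test)
    show "cmod (F z k * a k) \<le> M * cmod (a k)" if "z \<in> S" for z k
      using bound[OF that, of k] by (simp add: norm_mult mult_right_mono)
    show "summable (\<lambda>k. M * cmod (a k))" using a by (simp add: l1_def summable_mult)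
  qed
  then show "continuous_on S (\<lambda>z. \<Sum>k. F z k * a k)"
    by (rule uniform_limit_theorem[rotated])
      (auto intro!: always_eventually continuous_intros cont)
qed

lemma weak_star_continuous_on_coordinate:
  assumes "weak_star_continuous_on S F"
  shows "continuous_on S (\<lambda>z. F z k)"
proof -
  define e :: cseq where "e = (\<lambda>j. if j = k then 1 else 0)"
  have "e \<in> l1" unfolding l1_def e_def by (intro CollectI summable_finite[of "{k}"]) auto
  then have "continuous_on S (\<lambda>z. \<Sum>j. F z j * e j)"
    using assms by (simp add: weak_star_continuous_on_def)
  moreover have "(\<Sum>j. F z j * e j) = F z k" for z
    by (subst suminf_finite[of "{k}"]) (auto simp: e_def)
  ultimately show ?thesis by simp
qed

text \<open>Together with \<open>calF_holomorphic\<close>, \<open>calF_continuous\<close>, \<open>calF_coordinate_le\<close> and \<open>calF_right\<close>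
this reduces all work with \<^const>\<open>calF\<close> to scalar functions that are bounded uniformly in the
coordinate.\<close>

theorem calFI:
  assumes hol: "\<And>k. (\<lambda>z. F z k) holomorphic_on strip"
    and cont: "\<And>k. continuous_on closed_strip (\<lambda>z. F z k)"
    and bound: "\<And>z k. z \<in> closed_strip \<Longrightarrow> cmod (F z k) \<le> M"
    and left: "\<And>t k. cmod (F (\<i> * of_real t) k) \<le> B"
    and right: "\<And>t n. (\<Sum>k<n. cmod (F (1 + \<i> * of_real t) k)) \<le> B"
  shows "F \<in> calF" "calF_norm F \<le> B"
proof -
  have l1: "F (1 + \<i> * of_real t) \<in> l1 \<and> l1_norm (F (1 + \<i> * of_real t)) \<le> B" for t
    using l1_iff right by (rule iffD2[OF _ allI])
  have le: "r \<le> B" if "r \<in> boundary_norms F" for r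
    using that left l1 unfolding boundary_norms_def by (elim UnE imageE) (simp_all add: linf_norm_le)
  have linf: "F z \<in> linf" if "z \<in> closed_strip" for z
    using bound[OF that] by (auto simp: linf_iff)
  have "\<exists>D. has_linf_derivative F D z" if z: "z \<in> strip" for z
  proof -
    obtain r where r: "r > 0" "ball z r \<subseteq> strip" by (rule openE[OF open_strip z])
    then have "ball z r \<subseteq> closed_strip" using strip_subset by blast
    then have "has_linf_derivative F (\<lambda>k. deriv (\<lambda>w. F w k) z) z"
      using hol bound r
      by (intro has_linf_derivative_if_coordinates_bounded[where r = r and M = M])
        (auto intro: holomorphic_on_subset)
    then show ?thesis by blast
  qed
  moreover have "bdd_above ((\<lambda>z. linf_norm (F z)) ` strip)"
    using bound strip_subset by (auto intro!: bdd_aboveI[of _ M] linf_norm_le)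
  moreover have "F (1 + \<i> * of_real t) \<in> l1" for t using l1 by blast
  moreover have "bdd_above (boundary_norms F)" using le by (rule bdd_aboveI)
  ultimately show "F \<in> calF"
    using linf weak_star_continuous_onI[OF cont bound] by (simp add: calF_def)
  show "calF_norm F \<le> B"
    unfolding calF_norm_def by (rule cSup_least) (use le in \<open>auto simp: boundary_norms_def\<close>)
qed

lemma calF_continuous: "F \<in> calF \<Longrightarrow> continuous_on closed_strip (\<lambda>z. F z k)"
  by (rule weak_star_continuous_on_coordinate) (simp add: calF_def)

lemma calF_holomorphic:
  assumes "F \<in> calF"
  shows "(\<lambda>z. F z k) holomorphic_on strip"
  unfolding holomorphic_on_open[OF open_strip]
proof
  fix z assume z: "z \<in> strip"
  then obtain D where "has_linf_derivative F D z" using assms by (auto simp: calF_def)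
  then have "((\<lambda>w. F w k) has_field_derivative D k) (at z)"
    using assms strip_subset z
    by (intro has_linf_derivative_coordinate[where S = strip] open_strip) (auto simp: calF_def)
  then show "\<exists>f'. ((\<lambda>w. F w k) has_field_derivative f') (at z)" ..
qed

lemma boundary_norm_le_calF_norm: "F \<in> calF \<Longrightarrow> r \<in> boundary_norms F \<Longrightarrow> r \<le> calF_norm F"
  unfolding calF_norm_def by (rule cSup_upper) (auto simp: calF_def)

lemma calF_left:
  assumes "F \<in> calF"
  shows "cmod (F (\<i> * of_real t) k) \<le> calF_norm F"
proof -
  have "F (\<i> * of_real t) \<in> linf" using assms boundary_in_closed_strip by (simp add: calF_def)
  then have "cmod (F (\<i> * of_real t) k) \<le> linf_norm (F (\<i> * of_real t))"
    by (rule coordinate_le_linf_norm)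
  also have "\<dots> \<le> calF_norm F"
    by (rule boundary_norm_le_calF_norm[OF assms]) (simp add: boundary_norms_def)
  finally show ?thesis .
qed

lemma calF_right:
  assumes "F \<in> calF"
  shows "(\<Sum>k<n. cmod (F (1 + \<i> * of_real t) k)) \<le> calF_norm F"
proof -
  have "l1_norm (F (1 + \<i> * of_real t)) \<le> calF_norm F"
    by (rule boundary_norm_le_calF_norm[OF assms]) (simp add: boundary_norms_def)
  moreover have "F (1 + \<i> * of_real t) \<in> l1" using assms by (simp add: calF_def)
  ultimately show ?thesis using l1_iff by blast
qed

text \<open>The maximum principle turns the a priori bound in the definition of \<^const>\<open>calF\<close> into a bound by the
boundary norm.  On the right-hand line the sup norm is dominated by the \<^const>\<open>l1\<close> norm.\<close>

lemma calF_coordinate_le: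
  assumes F: "F \<in> calF" and z: "z \<in> closed_strip"
  shows "cmod (F z k) \<le> calF_norm F"
proof -
  obtain M where M: "\<And>w. w \<in> strip \<Longrightarrow> linf_norm (F w) \<le> M"
    using F by (auto simp: calF_def bdd_above_def)
  have "cmod (F w k) \<le> max M (calF_norm F)" if "w \<in> closed_strip" for w
    using that
  proof (cases rule: closed_strip_cases)
    case 1
    then show ?thesis
      using M[of w] coordinate_le_linf_norm[of "F w" k] F that by (simp add: calF_def)
  qed (use calF_left[OF F] coordinate_le_partial_sums[OF calF_right[OF F]] in
      \<open>auto simp: le_max_iff_disj\<close>)
  then show ?thesis
    by (rule strip_maximum_modulus[OF calF_holomorphic[OF F] calF_continuous[OF F] _
        calF_left[OF F] coordinate_le_partial_sums[OF calF_right[OF F]] z])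
qed

lemma calF_norm_nonneg: "F \<in> calF \<Longrightarrow> 0 \<le> calF_norm F"
  using calF_left[of F 0 0] norm_ge_zero order_trans by blast

lemma calF_multiply:
  assumes F: "F \<in> calF" and hol: "\<phi> holomorphic_on strip" and cont: "continuous_on closed_strip \<phi>"
    and bound: "\<And>z. z \<in> closed_strip \<Longrightarrow> cmod (\<phi> z) \<le> C"
  shows "(\<lambda>z. \<phi> z *\<^sub>C F z) \<in> calF" "calF_norm (\<lambda>z. \<phi> z *\<^sub>C F z) \<le> C * calF_norm F"
proof -
  have C: "0 \<le> C" using bound[OF boundary_in_closed_strip(1)] norm_ge_zero order_trans by blast
  have 1: "(\<lambda>z. (\<phi> z *\<^sub>C F z) k) holomorphic_on strip" for k
    using holomorphic_on_mult[OF hol calF_holomorphic[OF F]] by simp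
  have 2: "continuous_on closed_strip (\<lambda>z. (\<phi> z *\<^sub>C F z) k)" for k
    using continuous_on_mult[OF cont calF_continuous[OF F]] by simp
  have 3: "cmod ((\<phi> z *\<^sub>C F z) k) \<le> C * calF_norm F" if "z \<in> closed_strip" for z k
    using mult_mono[OF bound[OF that] calF_coordinate_le[OF F that] C] by (simp add: norm_mult)
  have 4: "(\<Sum>k<n. cmod ((\<phi> z *\<^sub>C F z) k)) \<le> C * calF_norm F" if "z = 1 + \<i> * of_real t" for z t n
  proof -
    have "(\<Sum>k<n. cmod ((\<phi> z *\<^sub>C F z) k)) = cmod (\<phi> z) * (\<Sum>k<n. cmod (F z k))"
      by (simp add: norm_mult sum_distrib_left)
    also have "\<dots> \<le> C * calF_norm F"
      using that calF_right[OF F] bound[OF boundary_in_closed_strip(2)]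
      by (intro mult_mono C sum_nonneg) auto
    finally show ?thesis .
  qed
  show "(\<lambda>z. \<phi> z *\<^sub>C F z) \<in> calF" "calF_norm (\<lambda>z. \<phi> z *\<^sub>C F z) \<le> C * calF_norm F"
    by (rule calFI[OF 1 2 3 3[OF boundary_in_closed_strip(1)] 4[OF refl]], assumption)+
qed

lemma calF_add:
  assumes F: "F \<in> calF" and G: "G \<in> calF"
  shows "F + G \<in> calF" "calF_norm (F + G) \<le> calF_norm F + calF_norm G"
proof -
  have 1: "(\<lambda>z. (F + G) z k) holomorphic_on strip" for k
    using holomorphic_on_add[OF calF_holomorphic[OF F] calF_holomorphic[OF G]] by simp
  have 2: "continuous_on closed_strip (\<lambda>z. (F + G) z k)" for k
    using continuous_on_add[OF calF_continuous[OF F] calF_continuous[OF G]] by simp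
  have 3: "cmod ((F + G) z k) \<le> calF_norm F + calF_norm G" if "z \<in> closed_strip" for z k
    using norm_triangle_mono[OF calF_coordinate_le[OF F that] calF_coordinate_le[OF G that]] by simp
  have 4: "(\<Sum>k<n. cmod ((F + G) (1 + \<i> * of_real t) k)) \<le> calF_norm F + calF_norm G" for t n
  proof -
    have "(\<Sum>k<n. cmod ((F + G) (1 + \<i> * of_real t) k))
      \<le> (\<Sum>k<n. cmod (F (1 + \<i> * of_real t) k) + cmod (G (1 + \<i> * of_real t) k))"
      by (intro sum_mono) (simp add: norm_triangle_ineq)
    also have "\<dots> \<le> calF_norm F + calF_norm G"
      unfolding sum.distrib by (intro add_mono calF_right F G)
    finally show ?thesis .
  qed
  show "F + G \<in> calF" "calF_norm (F + G) \<le> calF_norm F + calF_norm G"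
    by (rule calFI[OF 1 2 3 3[OF boundary_in_closed_strip(1)] 4], assumption)+
qed

lemma calF_scale:
  assumes "F \<in> calF"
  shows "a *\<^sub>C F \<in> calF" "calF_norm (a *\<^sub>C F) \<le> cmod a * calF_norm F"
  using calF_multiply[OF assms, of "\<lambda>_. a" "cmod a"] by (simp_all add: scaleC_fun_def)

lemma csubspace_calF: "csubspace calF"
proof -
  have "(0 :: complex \<Rightarrow> cseq) \<in> calF" by (rule calFI[where M = 0 and B = 0]) auto
  then show ?thesis using calF_add calF_scale by (auto simp: csubspace_def)
qed

lemma calF_diff:
  assumes F: "F \<in> calF" and G: "G \<in> calF"
  shows "F - G \<in> calF" "calF_norm (F - G) \<le> calF_norm F + calF_norm G"
  using calF_add[OF F calF_scale(1)[OF G, of "-1"]] calF_scale(2)[OF G, of "-1"]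
  by (simp_all add: scaleC_uminus_one)

text \<open>By \<open>calF_coordinate_le\<close> a Cauchy sequence converges uniformly on the closed strip in each
coordinate.  The bound on the \<^const>\<open>l1\<close> norms passes to the limit through finite partial sums.\<close>

lemma complete_on_calF: "complete_on calF calF_norm"
  unfolding complete_on_def
proof (intro allI impI, elim conjE)
  fix X :: "nat \<Rightarrow> complex \<Rightarrow> cseq"
  assume X: "\<forall>n. X n \<in> calF" and c: "\<forall>e>0. \<exists>M. \<forall>m\<ge>M. \<forall>n\<ge>M. calF_norm (X m - X n) < e"
  have X': "X n \<in> calF" "X m - X n \<in> calF" for m n
    using X csubspace_diff[OF csubspace_calF] by auto
  have diff: "cmod (X m z k - X n z k) \<le> calF_norm (X m - X n)" if "z \<in> closed_strip" for m n z k
    using calF_coordinate_le[OF X'(2) that, of m n k] by simp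
  have "uniformly_Cauchy_on closed_strip (\<lambda>n z. X n z k)" for k
  proof (rule uniformly_Cauchy_onI')
    fix e :: real assume "e > 0"
    then obtain M where "\<forall>m\<ge>M. \<forall>n\<ge>M. calF_norm (X m - X n) < e" using c by blast
    then show "\<exists>M. \<forall>z\<in>closed_strip. \<forall>m\<ge>M. \<forall>n>m. dist (X m z k) (X n z k) < e"
      unfolding dist_norm using diff by (meson le_less_trans less_imp_le order_trans)
  qed
  then have "\<exists>l. uniform_limit closed_strip (\<lambda>n z. X n z k) l sequentially" for k
    by (simp add: Cauchy_uniformly_convergent uniformly_convergent_on_def[symmetric])
  then obtain l where l: "\<And>k. uniform_limit closed_strip (\<lambda>n z. X n z k) (l k) sequentially"
    by metis
  define F where "F z k = l k z" for z k
  have lim: "(\<lambda>n. X n z k) \<longlonglongrightarrow> F z k" if "z \<in> closed_strip" for z k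
    using tendsto_uniform_limitI[OF l that] by (simp add: F_def)
  have cont: "continuous_on closed_strip (\<lambda>z. F z k)" for k
    using l[of k] unfolding F_def
    by (intro uniform_limit_theorem[where f = "\<lambda>n z. X n z k" and F = sequentially])
      (simp_all add: calF_continuous X')
  have hol: "(\<lambda>z. F z k) holomorphic_on strip" for k
  proof (rule holomorphic_uniform_sequence[OF open_strip, where f = "\<lambda>n z. X n z k"])
    fix z assume "z \<in> strip"
    then obtain d where "d > 0" "cball z d \<subseteq> strip"
      using open_strip[unfolded open_contains_cball] by (auto elim: ballE)
    moreover have "uniform_limit (cball z d) (\<lambda>n z. X n z k) (\<lambda>z. F z k) sequentially"
      using l \<open>cball z d \<subseteq> strip\<close> strip_subset unfolding F_def
      by (intro uniform_limit_on_subset[OF l]) auto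
    ultimately show "\<exists>d>0. cball z d \<subseteq> strip \<and>
        uniform_limit (cball z d) (\<lambda>n z. X n z k) (\<lambda>z. F z k) sequentially" by blast
  qed (intro calF_holomorphic X')
  have approx: "X n - F \<in> calF \<and> calF_norm (X n - F) \<le> e"
    if M: "\<And>m. m \<ge> M \<Longrightarrow> calF_norm (X n - X m) \<le> e" for M n e
  proof -
    have ev: "\<forall>\<^sub>F m in sequentially. calF_norm (X n - X m) \<le> e"
      unfolding eventually_sequentially using M by blast
    have 1: "(\<lambda>z. (X n - F) z k) holomorphic_on strip" for k
      using holomorphic_on_diff[OF calF_holomorphic[OF X'(1)] hol] by simp
    have 2: "continuous_on closed_strip (\<lambda>z. (X n - F) z k)" for k
      using continuous_on_diff[OF calF_continuous[OF X'(1)] cont] by simp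
    have 3: "cmod ((X n - F) z k) \<le> e" if z: "z \<in> closed_strip" for z k
    proof (rule tendsto_upperbound)
      show "(\<lambda>m. cmod (X n z k - X m z k)) \<longlonglongrightarrow> cmod ((X n - F) z k)"
        unfolding fun_diff_def using lim[OF z] by (intro tendsto_intros)
      show "\<forall>\<^sub>F m in sequentially. cmod (X n z k - X m z k) \<le> e"
        using ev by (rule eventually_mono) (use diff[OF z] order_trans in blast)
    qed simp
    have 4: "(\<Sum>k<N. cmod ((X n - F) (1 + \<i> * of_real t) k)) \<le> e" for t N
    proof (rule tendsto_upperbound)
      let ?z = "1 + \<i> * complex_of_real t"
      show "(\<lambda>m. \<Sum>k<N. cmod (X n ?z k - X m ?z k)) \<longlonglongrightarrow> (\<Sum>k<N. cmod ((X n - F) ?z k))"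
        unfolding fun_diff_def using lim[OF boundary_in_closed_strip(2)] by (intro tendsto_intros)
      have "(\<Sum>k<N. cmod (X n ?z k - X m ?z k)) \<le> calF_norm (X n - X m)" for m
        using calF_right[OF X'(2)[of n m], of t N] by simp
      then show "\<forall>\<^sub>F m in sequentially. (\<Sum>k<N. cmod (X n ?z k - X m ?z k)) \<le> e"
        by (intro eventually_mono[OF ev]) (use order_trans in blast)
    qed simp
    show ?thesis
      using calFI[OF 1 2 3 3[OF boundary_in_closed_strip(1)] 4] by blast
  qed
  obtain M where "\<forall>m\<ge>M. \<forall>n\<ge>M. calF_norm (X m - X n) < 1" using c zero_less_one by blast
  then have "X M - F \<in> calF" using approx[of M M 1] by force
  then have F: "F \<in> calF" using csubspace_diff[OF csubspace_calF X'(1), of "X M - F" M] by simp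
  have "(\<lambda>n. calF_norm (X n - F)) \<longlonglongrightarrow> 0"
  proof (rule LIMSEQ_I)
    fix e :: real assume "e > 0"
    then obtain M where M: "\<forall>m\<ge>M. \<forall>n\<ge>M. calF_norm (X m - X n) < e / 2"
      using c half_gt_zero by blast
    have "norm (calF_norm (X n - F) - 0) < e" if "n \<ge> M" for n
    proof -
      have "X n - F \<in> calF \<and> calF_norm (X n - F) \<le> e / 2"
        using M that by (intro approx[of M]) (simp add: less_imp_le)
      then show ?thesis using calF_norm_nonneg[of "X n - F"] \<open>e > 0\<close> by simp
    qed
    then show "\<exists>no. \<forall>n\<ge>no. norm (calF_norm (X n - F) - 0) < e" by blast
  qed
  then show "\<exists>F\<in>calF. (\<lambda>n. calF_norm (X n - F)) \<longlonglongrightarrow> 0" using F by blast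
qed

interpretation calF: complete_seminormed calF calF_norm
  using csubspace_calF calF_norm_nonneg calF_scale calF_add complete_on_calF
  by unfold_locales

section \<open>Taylor coefficients at the centre of the strip\<close>

text \<open>The unnormalised derivatives at the centre.  They are taken coordinatewise, to avoid the definite
description in \<^const>\<open>linf_deriv\<close>; \<open>higher_linf_deriv_half\<close> relates the two.\<close>

definition jet :: "nat \<Rightarrow> (complex \<Rightarrow> cseq) \<Rightarrow> cseq" where
  "jet i F = (\<lambda>k. (deriv ^^ i) (\<lambda>z. F z k) (1/2))"

lemma jet_0: "jet 0 F = F (1/2)"
  by (simp add: jet_def)

lemma higher_linf_deriv_half:
  assumes "F \<in> calF"
  shows "(linf_deriv ^^ i) F (1/2) = jet i F"
  unfolding jet_def
  using assms strip_subset
  by (intro higher_linf_deriv_eq[OF open_strip calF_holomorphic _ half_in_strip,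
        where M = "calF_norm F"]) (auto intro: calF_coordinate_le)

lemma jet_add:
  assumes "F \<in> calF" "G \<in> calF"
  shows "jet i (F + G) = jet i F + jet i G"
  using higher_deriv_add[OF calF_holomorphic[OF assms(1)] calF_holomorphic[OF assms(2)]
      open_strip half_in_strip]
  by (simp add: jet_def fun_eq_iff)

lemma jet_diff:
  assumes "F \<in> calF" "G \<in> calF"
  shows "jet i (F - G) = jet i F - jet i G"
  using higher_deriv_diff[OF calF_holomorphic[OF assms(1)] calF_holomorphic[OF assms(2)]
      open_strip half_in_strip]
  by (simp add: jet_def fun_eq_iff)

lemma jet_scale:
  assumes "F \<in> calF"
  shows "jet i (a *\<^sub>C F) = a *\<^sub>C jet i F"
  using higher_deriv_cmult[OF calF_holomorphic[OF assms] half_in_strip open_strip]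
  by (simp add: jet_def fun_eq_iff scaleC_fun_def scaleC_complex_def)

lemma half_ball_subset: "ball (1/2) (1/2) \<subseteq> strip"
proof
  fix z :: complex assume "z \<in> ball (1/2) (1/2)"
  then have "cmod (z - 1/2) < 1/2" by (simp add: dist_norm norm_minus_commute)
  then have "\<bar>Re z - 1/2\<bar> < 1/2" using abs_Re_le_cmod[of "z - 1/2"] by simp
  then have "0 < Re z" "Re z < 1" by linarith+
  then show "z \<in> strip" by (simp add: strip_def)
qed

lemma deriv_half_bound:
  assumes "f holomorphic_on strip" "\<And>w. w \<in> strip \<Longrightarrow> cmod (f w) \<le> M"
  shows "cmod ((deriv ^^ i) f (1/2)) \<le> fact i * M / (1/8) ^ i"
proof -
  have "cmod ((deriv ^^ i) f (1/2)) \<le> fact i * M / (1/2 / 4) ^ i"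
    using half_ball_subset assms(2)
    by (intro higher_deriv_bound[OF holomorphic_on_subset[OF assms(1) half_ball_subset]]) auto
  then show ?thesis by simp
qed

lemma jet_bound:
  assumes "F \<in> calF"
  shows "cmod (jet i F k) \<le> fact i * calF_norm F / (1/8) ^ i"
  unfolding jet_def
  using calF_coordinate_le[OF assms] strip_subset
  by (intro deriv_half_bound calF_holomorphic[OF assms]) auto

lemma jet_in_linf: "F \<in> calF \<Longrightarrow> jet i F \<in> linf"
  using jet_bound by (auto simp: linf_iff)

text \<open>Taylor coefficients are continuous by Cauchy's estimate, so the lifts of a nonzero
coefficient stay at a positive distance from \<open>0\<close>.  This is what makes all the quotient seminorms below norms.\<close>

lemma jet_separated:
  assumes "\<And>e. e > 0 \<Longrightarrow> \<exists>G\<in>calF. jet i G = jet i F \<and> calF_norm G < e"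
  shows "jet i F = 0"
proof
  fix k
  define c :: real where "c = fact i / (1/8) ^ i"
  have c: "c > 0" by (simp add: c_def)
  have "cmod (jet i F k) \<le> 0 + e" if "e > 0" for e
  proof -
    have "e / c > 0" using c that by simp
    from assms[OF this] obtain G where
      G: "G \<in> calF" "jet i G = jet i F" "calF_norm G < e / c" by blast
    have "cmod (jet i F k) \<le> c * calF_norm G"
      using jet_bound[OF G(1), of i k] G(2) by (simp add: c_def)
    also have "\<dots> \<le> e" using G(3) c by (simp add: field_simps)
    finally show ?thesis by simp
  qed
  then have "cmod (jet i F k) \<le> 0" by (rule field_le_epsilon)
  then show "jet i F k = 0 k" by simp
qed

section \<open>Extremal functions\<close>

text \<open>Membership and norm are expressed by finite sums, the form in which the duality estimates produce
them.\<close>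

lemma l2_iff:
  assumes "0 \<le> B"
  shows "x \<in> l2 \<and> l2_norm x \<le> B \<longleftrightarrow> (\<forall>n. (\<Sum>k<n. (cmod (x k))\<^sup>2) \<le> B\<^sup>2)"
proof
  assume x: "x \<in> l2 \<and> l2_norm x \<le> B"
  then have "(\<Sum>k. (cmod (x k))\<^sup>2) \<le> B\<^sup>2"
    unfolding l2_norm_def by (intro sqrt_le_D) simp
  moreover have "(\<Sum>k<n. (cmod (x k))\<^sup>2) \<le> (\<Sum>k. (cmod (x k))\<^sup>2)" for n
    using x by (intro sum_le_suminf) (auto simp: l2_def)
  ultimately show "\<forall>n. (\<Sum>k<n. (cmod (x k))\<^sup>2) \<le> B\<^sup>2" by (meson order_trans)
next
  assume *: "\<forall>n. (\<Sum>k<n. (cmod (x k))\<^sup>2) \<le> B\<^sup>2"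
  then have s: "summable (\<lambda>k. (cmod (x k))\<^sup>2)" by (intro summableI_nonneg_bounded) auto
  then have "(\<Sum>k. (cmod (x k))\<^sup>2) \<le> B\<^sup>2" using * by (intro suminf_le_const) auto
  then show "x \<in> l2 \<and> l2_norm x \<le> B"
    using s assms by (auto simp: l2_def l2_norm_def intro: real_le_lsqrt)
qed

lemma l2_norm_nonneg: "x \<in> l2 \<Longrightarrow> 0 \<le> l2_norm x"
  by (simp add: l2_norm_def l2_def suminf_nonneg)

lemma l2_partial_sums: "x \<in> l2 \<Longrightarrow> (\<Sum>k<n. (cmod (x k))\<^sup>2) \<le> (l2_norm x)\<^sup>2"
  using l2_iff[OF l2_norm_nonneg, of x x] by simp

lemma coordinate_le_l2_norm:
  assumes "x \<in> l2"
  shows "cmod (x k) \<le> l2_norm x"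
proof -
  have "(cmod (x k))\<^sup>2 \<le> (\<Sum>k<Suc k. (cmod (x k))\<^sup>2)" by (simp add: sum_nonneg)
  also have "\<dots> \<le> (l2_norm x)\<^sup>2" by (rule l2_partial_sums[OF assms])
  finally show ?thesis using l2_norm_nonneg[OF assms] by (rule power2_le_imp_le)
qed

lemma l2_finite_support:
  assumes "\<And>k. k \<ge> n \<Longrightarrow> x k = 0"
  shows "x \<in> l2" "l2_norm x = sqrt (\<Sum>k<n. (cmod (x k))\<^sup>2)"
proof -
  have 0: "(cmod (x k))\<^sup>2 = 0" if "k \<notin> {..<n}" for k using assms[of k] that by simp
  show "x \<in> l2" unfolding l2_def using summable_finite[OF finite_lessThan 0] by simp
  show "l2_norm x = sqrt (\<Sum>k<n. (cmod (x k))\<^sup>2)"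
    unfolding l2_norm_def using suminf_finite[OF finite_lessThan 0] by simp
qed

text \<open>For \<open>\<parallel>x\<parallel>\<^sub>2 = 1\<close> this is \<open>x |x|\<^bsup>2z - 1\<^esup>\<close>: unimodular on the support of \<open>x\<close> for \<open>Re z = 0\<close>, equal
to \<open>x\<close> at \<open>1/2\<close>, and of modulus \<open>|x|\<^sup>2\<close> for \<open>Re z = 1\<close>.  Its norm is the least
possible among the functions in \<^const>\<open>calF\<close> with value \<open>x\<close> at \<open>1/2\<close>.\<close>

definition extremal :: "cseq \<Rightarrow> complex \<Rightarrow> cseq" where
  "extremal x z = (\<lambda>k. x k * exp ((2 * z - 1) * of_real (ln (cmod (x k) / l2_norm x))))"

lemma cmod_extremal:
  assumes "x \<in> l2" "x k \<noteq> 0"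
  shows "cmod (extremal x z k) = l2_norm x * exp (2 * Re z * ln (cmod (x k) / l2_norm x))"
proof -
  let ?r = "cmod (x k) / l2_norm x"
  have s: "0 < l2_norm x" using coordinate_le_l2_norm[OF assms(1), of k] assms(2)
    by (meson less_le_trans zero_less_norm_iff)
  have "cmod (extremal x z k) = cmod (x k) * exp ((2 * Re z - 1) * ln ?r)"
    by (simp add: extremal_def norm_mult norm_exp_eq_Re)
  also have "\<dots> = l2_norm x * exp (ln ?r) * exp ((2 * Re z - 1) * ln ?r)"
    using s assms(2) by simp
  also have "\<dots> = l2_norm x * exp (ln ?r + (2 * Re z - 1) * ln ?r)"
    by (simp only: exp_add mult.assoc)
  also have "ln ?r + (2 * Re z - 1) * ln ?r = 2 * Re z * ln ?r" by (simp add: algebra_simps)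
  finally show ?thesis .
qed

lemma cmod_extremal_le:
  assumes "x \<in> l2" "0 \<le> Re z"
  shows "cmod (extremal x z k) \<le> l2_norm x"
proof (cases "x k = 0")
  case True
  then show ?thesis using l2_norm_nonneg[OF assms(1)] by (simp add: extremal_def)
next
  case False
  have s: "0 < l2_norm x" using coordinate_le_l2_norm[OF assms(1), of k] False
    by (meson less_le_trans zero_less_norm_iff)
  have "ln (cmod (x k) / l2_norm x) \<le> 0"
    using coordinate_le_l2_norm[OF assms(1), of k] False s by (intro ln_le_zero_iff[THEN iffD2]) auto
  then have "exp (2 * Re z * ln (cmod (x k) / l2_norm x)) \<le> 1"
    using assms(2) by (simp add: mult_nonneg_nonpos)
  then show ?thesis
    using cmod_extremal[OF assms(1) False] s by (simp add: mult_left_le)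
qed

lemma sum_cmod_extremal_le:
  assumes "x \<in> l2" "Re z = 1"
  shows "(\<Sum>k<n. cmod (extremal x z k)) \<le> l2_norm x"
proof -
  let ?s = "l2_norm x"
  have "cmod (extremal x z k) = (cmod (x k))\<^sup>2 / ?s" for k
  proof (cases "x k = 0")
    case False
    have s: "0 < ?s" using coordinate_le_l2_norm[OF assms(1), of k] False
      by (meson less_le_trans zero_less_norm_iff)
    have "exp (2 * ln (cmod (x k) / ?s)) = (exp (ln (cmod (x k) / ?s)))\<^sup>2"
      by (simp add: exp_double)
    also have "\<dots> = (cmod (x k) / ?s)\<^sup>2" using s False by simp
    finally show ?thesis
      using cmod_extremal[OF assms(1) False, of z] assms(2) s
      by (simp add: power2_eq_square)
  qed (simp add: extremal_def)
  then have "(\<Sum>k<n. cmod (extremal x z k)) = (\<Sum>k<n. (cmod (x k))\<^sup>2) / ?s"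
    by (simp add: sum_divide_distrib)
  also have "\<dots> \<le> ?s\<^sup>2 / ?s"
    by (intro divide_right_mono l2_partial_sums assms l2_norm_nonneg)
  also have "\<dots> = ?s" by (simp add: power2_eq_square)
  finally show ?thesis .
qed

lemma holomorphic_extremal: "(\<lambda>z. extremal x z k) holomorphic_on S"
  unfolding extremal_def by (intro holomorphic_intros)

lemma extremal_in_calF:
  assumes "x \<in> l2"
  shows "extremal x \<in> calF" "calF_norm (extremal x) \<le> l2_norm x"
proof -
  have 1: "continuous_on closed_strip (\<lambda>z. extremal x z k)" for k
    by (rule holomorphic_on_imp_continuous_on[OF holomorphic_extremal])
  have 2: "cmod (extremal x z k) \<le> l2_norm x" if "z \<in> closed_strip" for z k
    using that assms by (intro cmod_extremal_le) (auto simp: closed_strip_def)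
  have 3: "(\<Sum>k<n. cmod (extremal x (1 + \<i> * of_real t) k)) \<le> l2_norm x" for n t
    using assms by (intro sum_cmod_extremal_le) auto
  show "extremal x \<in> calF" "calF_norm (extremal x) \<le> l2_norm x"
    by (rule calFI[OF holomorphic_extremal 1 2 2[OF boundary_in_closed_strip(1)] 3], assumption)+
qed

lemma jet_extremal: "jet i (extremal x) = (\<lambda>k. x k * (2 * of_real (ln (cmod (x k) / l2_norm x))) ^ i)"
proof
  fix k
  define c where "c = complex_of_real (ln (cmod (x k) / l2_norm x))"
  have "(deriv ^^ i) (\<lambda>z. x k * exp ((2 * z - 1) * c)) = (\<lambda>z. x k * (2 * c) ^ i * exp ((2 * z - 1) * c))"
  proof (induction i)
    case (Suc i)
    have "((\<lambda>z. x k * (2 * c) ^ i * exp ((2 * z - 1) * c)) has_field_derivative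
        x k * (2 * c) ^ Suc i * exp ((2 * z - 1) * c)) (at z)" for z
      by (auto intro!: derivative_eq_intros)
    then have "deriv (\<lambda>z. x k * (2 * c) ^ i * exp ((2 * z - 1) * c))
        = (\<lambda>z. x k * (2 * c) ^ Suc i * exp ((2 * z - 1) * c))"
      by (intro ext DERIV_imp_deriv)
    then show ?case using Suc by simp
  qed simp
  then show "jet i (extremal x) k = x k * (2 * of_real (ln (cmod (x k) / l2_norm x))) ^ i"
    by (simp add: jet_def extremal_def c_def)
qed

lemma jet_0_extremal: "jet 0 (extremal x) = x"
  and jet_1_extremal: "jet 1 (extremal x) = kp_map x"
  by (simp_all add: jet_extremal kp_map_def fun_eq_iff)

section \<open>Duality pairings\<close>

text \<open>The scalar function \<open>h(z) = \<Sum> F\<^sub>k(z) (extremal b)\<^sub>k(1 - z)\<close> pairs \<^const>\<open>linf\<close> with \<^const>\<open>l1\<close> on both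
boundary lines, because \<open>z \<mapsto> 1 - z\<close> exchanges them.  So it is bounded by the product of the norms,
uniformly in the number of terms.  Its value at \<open>1/2\<close> gives the duality of \<^const>\<open>l2\<close> with itself,
and its derivative there the symplectic duality of the Kalton--Peck space with itself.\<close>

lemma
  assumes F: "F \<in> calF" and b: "b \<in> l2"
  shows pairing_value: "cmod (\<Sum>k<n. jet 0 F k * b k) \<le> calF_norm F * l2_norm b"
    and pairing_derivative:
      "cmod (\<Sum>k<n. jet 1 F k * b k - jet 0 F k * kp_map b k) \<le> 8 * (calF_norm F * l2_norm b)"
proof -
  define h where "h z = (\<Sum>k<n. F z k * extremal b (1 - z) k)" for z
  have hol_ext: "(\<lambda>z. extremal b (1 - z) k) holomorphic_on S" for k S
    unfolding extremal_def by (intro holomorphic_intros)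
  have hol: "h holomorphic_on strip"
    unfolding h_def by (intro holomorphic_on_sum holomorphic_on_mult calF_holomorphic[OF F] hol_ext)
  have cont: "continuous_on closed_strip h"
    unfolding h_def
    by (intro continuous_on_sum continuous_on_mult calF_continuous[OF F]
        holomorphic_on_imp_continuous_on hol_ext)
  have tri: "cmod (h z) \<le> (\<Sum>k<n. cmod (F z k) * cmod (extremal b (1 - z) k))" for z
    unfolding h_def by (rule order_trans[OF norm_sum]) (simp add: norm_mult)
  have le: "cmod (h z) \<le> calF_norm F * l2_norm b" if z: "z \<in> closed_strip" for z
  proof (rule strip_maximum_modulus[OF hol cont _ _ _ z])
    \<comment> \<open>A crude bound that depends on \<open>n\<close>: the maximum principle only needs some bound inside.\<close>
    show "cmod (h w) \<le> (\<Sum>k<n. calF_norm F * l2_norm b)" if "w \<in> closed_strip" for w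
      using that calF_norm_nonneg[OF F]
      by (intro order_trans[OF tri] sum_mono mult_mono calF_coordinate_le F cmod_extremal_le b)
        (auto simp: closed_strip_def)
    show "cmod (h (\<i> * of_real t)) \<le> calF_norm F * l2_norm b" for t
    proof -
      let ?w = "\<i> * complex_of_real t"
      have "cmod (h ?w) \<le> (\<Sum>k<n. calF_norm F * cmod (extremal b (1 - ?w) k))"
        by (intro order_trans[OF tri] sum_mono mult_right_mono calF_left F) auto
      also have "\<dots> \<le> calF_norm F * l2_norm b"
        unfolding sum_distrib_left[symmetric]
        by (intro mult_left_mono sum_cmod_extremal_le b calF_norm_nonneg F) auto
      finally show ?thesis .
    qed
    show "cmod (h (1 + \<i> * of_real t)) \<le> calF_norm F * l2_norm b" for t
    proof -
      let ?w = "1 + \<i> * complex_of_real t"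
      have "cmod (h ?w) \<le> (\<Sum>k<n. cmod (F ?w k) * l2_norm b)"
        by (intro order_trans[OF tri] sum_mono mult_left_mono cmod_extremal_le b) auto
      also have "\<dots> \<le> calF_norm F * l2_norm b"
        unfolding sum_distrib_right[symmetric]
        by (intro mult_right_mono calF_right F l2_norm_nonneg b)
      finally show ?thesis .
    qed
  qed
  have half: "extremal b (1/2) = b" using jet_0_extremal[of b] by (simp add: jet_0)
  have "h (1/2) = (\<Sum>k<n. jet 0 F k * b k)" by (simp add: h_def jet_0 half)
  then show "cmod (\<Sum>k<n. jet 0 F k * b k) \<le> calF_norm F * l2_norm b"
    using le[of "1/2"] half_in_strip strip_subset by auto
  have "((\<lambda>z. extremal b (1 - z) k) has_field_derivative - kp_map b k) (at (1/2))" for k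
    unfolding extremal_def kp_map_def by (auto intro!: derivative_eq_intros)
  moreover have "((\<lambda>z. F z k) has_field_derivative jet 1 F k) (at (1/2))" for k
    using holomorphic_derivI[OF calF_holomorphic[OF F] open_strip half_in_strip]
    by (simp add: jet_def)
  ultimately have "(h has_field_derivative
      (\<Sum>k<n. F (1/2) k * (- kp_map b k) + jet 1 F k * extremal b (1 - 1/2) k)) (at (1/2))"
    unfolding h_def by (intro DERIV_sum DERIV_mult')
  then have "deriv h (1/2) = (\<Sum>k<n. jet 1 F k * b k - jet 0 F k * kp_map b k)"
    using half by (simp add: DERIV_imp_deriv jet_0 algebra_simps)
  moreover have "cmod ((deriv ^^ 1) h (1/2)) \<le> fact 1 * (calF_norm F * l2_norm b) / (1/8) ^ 1"
    using le strip_subset by (intro deriv_half_bound hol) auto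
  ultimately show "cmod (\<Sum>k<n. jet 1 F k * b k - jet 0 F k * kp_map b k) \<le> 8 * (calF_norm F * l2_norm b)"
    by simp
qed

lemma jet_0_in_l2:
  assumes F: "F \<in> calF"
  shows "jet 0 F \<in> l2" "l2_norm (jet 0 F) \<le> calF_norm F"
proof -
  have "(\<Sum>k<n. (cmod (jet 0 F k))\<^sup>2) \<le> (calF_norm F)\<^sup>2" for n
  proof -
    define b where "b k = (if k < n then cnj (jet 0 F k) else 0)" for k
    let ?S = "\<Sum>k<n. (cmod (jet 0 F k))\<^sup>2"
    have S: "0 \<le> ?S" by (simp add: sum_nonneg)
    have b: "b \<in> l2" "l2_norm b = sqrt ?S"
      using l2_finite_support[of n b] by (simp_all add: b_def)
    have "(\<Sum>k<n. jet 0 F k * b k) = of_real ?S"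
      by (simp add: b_def complex_norm_square[symmetric] del: of_real_power)
    then have "?S \<le> calF_norm F * sqrt ?S"
      using pairing_value[OF F b(1), of n] S b(2) by (simp del: of_real_sum)
    then have "sqrt ?S * sqrt ?S \<le> calF_norm F * sqrt ?S" using S by simp
    then have "sqrt ?S \<le> calF_norm F"
      using S calF_norm_nonneg[OF F]
      by (cases "?S = 0") (simp, metis less_eq_real_def mult_right_le_imp_le real_sqrt_gt_zero)
    then show ?thesis by (rule sqrt_le_D)
  qed
  then show "jet 0 F \<in> l2" "l2_norm (jet 0 F) \<le> calF_norm F"
    using l2_iff[OF calF_norm_nonneg[OF F]] by blast+
qed

section \<open>Multiplication and division by a function vanishing at the centre\<close>

text \<open>With \<open>w = z - 1/2\<close> this is \<open>w e\<^sup>w / (1 + w)\<close>.  The quotient \<open>w / (1 + w)\<close> is bounded above on the closed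
strip, and below away from the centre; the factor \<open>e\<^sup>w\<close> cancels its second-order term, so that
\<open>phi\<close> agrees with \<open>w\<close> up to order two.\<close>

definition phi :: "complex \<Rightarrow> complex" where
  "phi z = (z - 1/2) * exp (z - 1/2) / (z + 1/2)"

lemma closed_strip_plus_half: "z \<in> closed_strip \<Longrightarrow> z + 1/2 \<noteq> 0"
  by (auto simp: closed_strip_def complex_eq_iff)

lemma holomorphic_phi: "phi holomorphic_on strip"
  unfolding phi_def using closed_strip_plus_half strip_subset
  by (intro holomorphic_intros) auto

lemma continuous_phi: "continuous_on closed_strip phi"
  unfolding phi_def using closed_strip_plus_half by (intro continuous_intros) auto

lemma exp_half_le: "exp (1/2::real) \<le> 2"
proof -
  have "(exp (1/2::real))\<^sup>2 = exp 1" by (simp add: exp_double[symmetric])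
  also have "\<dots> \<le> 2\<^sup>2" using exp_le by simp
  finally show ?thesis by (rule power2_le_imp_le) simp
qed

lemma cmod_exp_centred_le:
  assumes "z \<in> closed_strip"
  shows "cmod (exp (z - 1/2)) \<le> 2" "cmod (exp (1/2 - z)) \<le> 2"
proof -
  have "exp (Re z - 1/2) \<le> exp (1/2)" "exp (1/2 - Re z) \<le> exp (1/2)"
    using assms by (auto simp: closed_strip_def)
  then show "cmod (exp (z - 1/2)) \<le> 2" "cmod (exp (1/2 - z)) \<le> 2"
    using order_trans[OF _ exp_half_le] by (auto simp: norm_exp_eq_Re simp del: exp_le_cancel_iff)
qed

lemma cmod_phi_le:
  assumes "z \<in> closed_strip"
  shows "cmod (phi z) \<le> 6"
proof -
  have "1/2 \<le> Re (z + 1/2)" using assms by (simp add: closed_strip_def)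
  also have "\<dots> \<le> cmod (z + 1/2)" by (rule complex_Re_le_cmod)
  finally have h: "1/2 \<le> cmod (z + 1/2)" .
  have "cmod (z - 1/2) = cmod ((z + 1/2) - 1)" by simp
  also have "\<dots> \<le> cmod (z + 1/2) + 1" using norm_triangle_ineq4[of "z + 1/2" 1] by simp
  finally have "cmod (z - 1/2) \<le> 3 * cmod (z + 1/2)" using h by simp
  then have "cmod (z - 1/2) * cmod (exp (z - 1/2)) \<le> 3 * cmod (z + 1/2) * 2"
    by (intro mult_mono cmod_exp_centred_le assms) auto
  then show ?thesis using h by (simp add: phi_def norm_mult norm_divide divide_le_eq)
qed

lemma
  shows phi_half: "phi (1/2) = 0"
    and deriv_phi_half: "deriv phi (1/2) = 1"
    and deriv2_phi_half: "(deriv ^^ 2) phi (1/2) = 0"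
proof -
  define d where "d z = exp (z - 1/2) * (1 - inverse (z + 1/2) + inverse (z + 1/2) ^ 2)" for z :: complex
  have ne: "z + 1/2 \<noteq> 0" if "z \<in> strip" for z
    using that closed_strip_plus_half strip_subset by blast
  have "(phi has_field_derivative d z) (at z)" if "z \<in> strip" for z
    unfolding phi_def d_def using ne[OF that]
    by (auto intro!: derivative_eq_intros simp: divide_simps power2_eq_square) (simp add: algebra_simps)
  then have d: "deriv phi z = d z" if "z \<in> strip" for z
    using that by (intro DERIV_imp_deriv)
  show "phi (1/2) = 0" by (simp add: phi_def)
  show "deriv phi (1/2) = 1" by (simp add: d[OF half_in_strip] d_def)
  have hold: "d holomorphic_on strip"
    unfolding d_def using ne by (intro holomorphic_intros) auto
  have "(deriv ^^ 2) phi (1/2) = deriv (deriv phi) (1/2)" by (simp add: numeral_2_eq_2)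
  also have "\<dots> = deriv d (1/2)"
    by (rule complex_derivative_transform_within_open[OF holomorphic_deriv[OF holomorphic_phi open_strip]
          hold open_strip half_in_strip d])
  also have "\<dots> = 0"
    unfolding d_def
    by (rule DERIV_imp_deriv) (auto intro!: derivative_eq_intros simp: power2_eq_square)
  finally show "(deriv ^^ 2) phi (1/2) = 0" .
qed

definition phi_times :: "(complex \<Rightarrow> cseq) \<Rightarrow> complex \<Rightarrow> cseq" where
  "phi_times F z = phi z *\<^sub>C F z"

lemma phi_times_in_calF:
  assumes "F \<in> calF"
  shows "phi_times F \<in> calF" "calF_norm (phi_times F) \<le> 6 * calF_norm F"
  using calF_multiply[OF assms holomorphic_phi continuous_phi cmod_phi_le]
  by (simp_all add: phi_times_def[abs_def])

text \<open>Leibniz' rule with \<open>phi = w + O(w\<^sup>3)\<close>: the Taylor coefficients move up by one place.\<close>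

lemma jet_phi_times:
  assumes F: "F \<in> calF"
  shows "jet 0 (phi_times F) = 0" "jet 1 (phi_times F) = jet 0 F"
    "jet 2 (phi_times F) = 2 *\<^sub>C jet 1 F"
proof -
  have leibniz: "jet n (phi_times F) k
      = (\<Sum>i=0..n. of_nat (n choose i) * (deriv ^^ i) phi (1/2) * jet (n - i) F k)" for n k
    using higher_deriv_mult[OF holomorphic_phi calF_holomorphic[OF F] open_strip half_in_strip]
    by (simp add: jet_def phi_times_def)
  have d2: "deriv (deriv phi) (1/2) = 0" using deriv2_phi_half by (simp add: numeral_2_eq_2)
  show "jet 0 (phi_times F) = 0" using leibniz[of 0] by (simp add: fun_eq_iff phi_half)
  show "jet 1 (phi_times F) = jet 0 F"
    using leibniz[of 1] by (simp add: fun_eq_iff phi_half deriv_phi_half)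
  show "jet 2 (phi_times F) = 2 *\<^sub>C jet 1 F"
    using leibniz[of 2] by (simp add: fun_eq_iff phi_half deriv_phi_half d2 numeral_2_eq_2)
qed

text \<open>\<open>F / phi\<close>, with the removable singularity at \<open>1/2\<close> filled in by the derivative of \<open>F\<close>.\<close>

definition phi_quotient :: "(complex \<Rightarrow> cseq) \<Rightarrow> complex \<Rightarrow> cseq" where
  "phi_quotient F z = (\<lambda>k. (z + 1/2) * exp (1/2 - z) *
     (if z = 1/2 then jet 1 F k else F z k / (z - 1/2)))"

lemma phi_times_quotient:
  assumes "F \<in> calF" "jet 0 F = 0" "z \<in> closed_strip"
  shows "phi z * phi_quotient F z k = F z k"
proof (cases "z = 1/2")
  case True
  show ?thesis unfolding True using assms(2) by (simp only: phi_half jet_0 fun_eq_iff) simp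
next
  case False
  have "exp (z - 1/2) * exp (1/2 - z) = 1" by (simp add: exp_add[symmetric])
  then have "phi z * phi_quotient F z k
      = (z - 1/2) / (z - 1/2) * ((z + 1/2) / (z + 1/2)) * (exp (z - 1/2) * exp (1/2 - z)) * F z k"
    using False by (simp add: phi_def phi_quotient_def mult_ac)
  then show ?thesis
    using False closed_strip_plus_half[OF assms(3)] \<open>exp (z - 1/2) * exp (1/2 - z) = 1\<close> by simp
qed

text \<open>Away from the centre \<open>1 / phi\<close> is bounded by \<open>10\<close>.  Inside the disc of radius \<open>1/4\<close> the estimate
is carried over from the bounding circle by the maximum principle.\<close>

lemma phi_quotient_in_calF:
  assumes F: "F \<in> calF" and 0: "jet 0 F = 0"
  shows "phi_quotient F \<in> calF" "calF_norm (phi_quotient F) \<le> 10 * calF_norm F"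
proof -
  have F0: "F (1/2) k = 0" for k using 0 by (simp add: jet_0 fun_eq_iff)
  have hol: "(\<lambda>z. phi_quotient F z k) holomorphic_on strip" for k
  proof -
    have "(\<lambda>z. if z = 1/2 then jet 1 F k else F z k / (z - 1/2)) holomorphic_on strip"
      using pole_lemma_open[OF calF_holomorphic[OF F, of k] open_strip, of "1/2"]
      by (simp add: jet_def F0 cong: if_cong)
    then show ?thesis unfolding phi_quotient_def by (intro holomorphic_intros)
  qed
  let ?D = "cball (1/2::complex) (1/4)" and ?E = "closed_strip - ball (1/2) (1/4)"
  have D: "?D \<subseteq> strip" using half_ball_subset by force
  have closed: "closed closed_strip"
  proof -
    have "closed_strip = {z. 0 \<le> Re z} \<inter> {z. Re z \<le> 1}" by (auto simp: closed_strip_def)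
    then show ?thesis using closed_Int[OF closed_halfspace_Re_ge[of 0] closed_halfspace_Re_le[of 1]] by argo
  qed
  have contD: "continuous_on ?D (\<lambda>z. phi_quotient F z k)" for k
    using continuous_on_subset[OF holomorphic_on_imp_continuous_on[OF hol] D] .
  have cont: "continuous_on closed_strip (\<lambda>z. phi_quotient F z k)" for k
  proof -
    have "1/2 \<notin> ?E" by simp
    then have nonzero: "\<forall>z\<in>?E. z - 1/2 \<noteq> 0" by (metis eq_iff_diff_eq_0)
    have "continuous_on ?E (\<lambda>z. (z + 1/2) * exp (1/2 - z) * (F z k / (z - 1/2)))"
      by (intro continuous_intros continuous_on_subset[OF calF_continuous[OF F]])
        (use nonzero in blast)+
    then have "continuous_on ?E (\<lambda>z. phi_quotient F z k)"
      by (rule continuous_on_eq) (use nonzero in \<open>auto simp: phi_quotient_def\<close>)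
    then have "continuous_on (?D \<union> ?E) (\<lambda>z. phi_quotient F z k)"
      using closed contD by (intro continuous_on_closed_Un) (auto intro: closed_Diff)
    moreover have "?D \<union> ?E = closed_strip" using D strip_subset ball_subset_cball by blast
    ultimately show ?thesis by simp
  qed
  have outer: "cmod (phi_quotient F z k) \<le> 10 * cmod (F z k)"
    if z: "z \<in> closed_strip" "1/4 \<le> cmod (z - 1/2)" for z k
  proof -
    have "cmod (z + 1/2) = cmod ((z - 1/2) + 1)" by (simp add: add.commute)
    also have "\<dots> \<le> cmod (z - 1/2) + 1" using norm_triangle_ineq[of "z - 1/2" 1] by simp
    also have "\<dots> \<le> 5 * cmod (z - 1/2)" using z by simp
    finally have "cmod (z + 1/2) * cmod (exp (1/2 - z)) \<le> 5 * cmod (z - 1/2) * 2"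
      by (intro mult_mono cmod_exp_centred_le z) auto
    then have "cmod (z + 1/2) * cmod (exp (1/2 - z)) * cmod (F z k) \<le> 10 * cmod (z - 1/2) * cmod (F z k)"
      by (intro mult_right_mono) auto
    moreover have "z \<noteq> 1/2"
    proof
      assume eq: "z = 1/2"
      show False using z(2) unfolding eq by simp
    qed
    ultimately show ?thesis
      by (simp add: phi_quotient_def norm_mult norm_divide divide_le_eq mult_ac)
  qed
  have outer': "cmod (phi_quotient F z k) \<le> 10 * calF_norm F"
    if "z \<in> closed_strip" "1/4 \<le> cmod (z - 1/2)" for z k
    using outer[OF that, of k] calF_coordinate_le[OF F that(1), of k] by simp
  have bound: "cmod (phi_quotient F z k) \<le> 10 * calF_norm F" if z: "z \<in> closed_strip" for z k
  proof (cases "1/4 \<le> cmod (z - 1/2)")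
    case False
    show ?thesis
    proof (rule maximum_modulus_frontier[where f = "\<lambda>z. phi_quotient F z k" and S = ?D])
      show "(\<lambda>z. phi_quotient F z k) holomorphic_on interior ?D"
        using D interior_subset by (intro holomorphic_on_subset[OF hol]) blast
      show "continuous_on (closure ?D) (\<lambda>z. phi_quotient F z k)" using contD by simp
      show "z \<in> ?D" using False by (simp add: dist_norm norm_minus_commute)
      show "cmod (phi_quotient F w k) \<le> 10 * calF_norm F" if "w \<in> frontier ?D" for w
      proof (rule outer')
        have w: "dist (1/2) w = 1/4" using that by simp
        then show "1/4 \<le> cmod (w - 1/2)" by (simp add: dist_norm norm_minus_commute)
        show "w \<in> closed_strip" using w D strip_subset by force
      qed
    qed simp
  qed (rule outer'[OF z])
  have right: "(\<Sum>k<n. cmod (phi_quotient F (1 + \<i> * of_real t) k)) \<le> 10 * calF_norm F" for t n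
  proof -
    let ?z = "1 + \<i> * complex_of_real t"
    have "1/4 \<le> Re (?z - 1/2)" by simp
    also have "\<dots> \<le> cmod (?z - 1/2)" by (rule complex_Re_le_cmod)
    finally have "(\<Sum>k<n. cmod (phi_quotient F ?z k)) \<le> (\<Sum>k<n. 10 * cmod (F ?z k))"
      by (intro sum_mono outer boundary_in_closed_strip)
    also have "\<dots> \<le> 10 * calF_norm F"
      using calF_right[OF F] by (simp add: sum_distrib_left[symmetric])
    finally show ?thesis .
  qed
  show "phi_quotient F \<in> calF" "calF_norm (phi_quotient F) \<le> 10 * calF_norm F"
    by (rule calFI[OF hol cont bound bound[OF boundary_in_closed_strip(1)] right], assumption)+
qed

lemma jet_cong:
  assumes "F \<in> calF" "G \<in> calF" "\<And>z k. z \<in> strip \<Longrightarrow> F z k = G z k"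
  shows "jet i F = jet i G"
  unfolding jet_def
  using higher_deriv_transform_within_open[OF calF_holomorphic[OF assms(1)]
      calF_holomorphic[OF assms(2)] open_strip half_in_strip assms(3)] by simp

lemma jet_phi_quotient:
  assumes F: "F \<in> calF" and 0: "jet 0 F = 0"
  shows "jet 0 (phi_quotient F) = jet 1 F" "2 *\<^sub>C jet 1 (phi_quotient F) = jet 2 F"
proof -
  note Q = phi_quotient_in_calF[OF assms]
  have "jet i (phi_times (phi_quotient F)) = jet i F" for i
    using strip_subset phi_times_quotient[OF assms]
    by (intro jet_cong phi_times_in_calF Q F) (auto simp: phi_times_def)
  then show "jet 0 (phi_quotient F) = jet 1 F" "2 *\<^sub>C jet 1 (phi_quotient F) = jet 2 F"
    using jet_phi_times[OF Q(1)] by simp_all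
qed

section \<open>The spaces as quotients of the space of analytic functions\<close>

interpretation l2: quotient_map calF calF_norm "jet 0"
  by unfold_locales (auto simp: jet_add jet_scale intro: jet_separated)

text \<open>Interpolating \<^const>\<open>linf\<close> and \<^const>\<open>l1\<close> half way gives \<^const>\<open>l2\<close>, isometrically as the proof
below shows; completeness of \<^const>\<open>l2\<close> is thereby inherited from \<^const>\<open>calF\<close>.\<close>

lemma l2_eq: "jet 0 ` calF = l2"
  using jet_0_in_l2(1) extremal_in_calF(1) jet_0_extremal by (force intro: rev_image_eqI)

lemma banach_on_l2: "banach_on l2 l2_norm"
proof (rule banach_on_cong[OF l2.banach_on_quotient[unfolded l2_eq]])
  fix x assume x: "x \<in> l2"
  have "quotient_norm calF calF_norm (jet 0) x \<le> l2_norm x"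
    using l2.quotient_norm_le[OF extremal_in_calF(1)[OF x]] extremal_in_calF(2)[OF x]
    by (simp add: jet_0_extremal)
  moreover have "l2_norm x \<le> quotient_norm calF calF_norm (jet 0) x"
    using x jet_0_in_l2(2) by (intro l2.quotient_norm_greatest) (auto simp: l2_eq)
  ultimately show "quotient_norm calF calF_norm (jet 0) x = l2_norm x" by (rule antisym)
qed

lemma csubspace_l2: "csubspace l2"
  using banach_on_l2 by (simp add: banach_on_def)

definition jet_pair :: "(complex \<Rightarrow> cseq) \<Rightarrow> cseq \<times> cseq" where
  "jet_pair F = (jet 1 F, jet 0 F)"

abbreviation Z2_norm :: "cseq \<times> cseq \<Rightarrow> real" where
  "Z2_norm \<equiv> quotient_norm calF calF_norm jet_pair"

interpretation Z2: quotient_map calF calF_norm jet_pair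
proof
  fix F assume "F \<in> calF" and *: "\<And>e. e > 0 \<Longrightarrow> \<exists>G\<in>calF. jet_pair G = jet_pair F \<and> calF_norm G < e"
  have "jet i F = 0" if "i < 2" for i
  proof (rule jet_separated)
    fix e :: real assume "e > 0"
    then show "\<exists>G\<in>calF. jet i G = jet i F \<and> calF_norm G < e"
      using *[of e] that by (auto simp: jet_pair_def less_2_cases_iff)
  qed
  then show "jet_pair F = 0" by (simp add: jet_pair_def zero_prod_def)
qed (auto simp: jet_pair_def jet_add jet_scale scaleC_prod_def)

text \<open>Subtracting the extremal function through \<open>F (1/2)\<close> leaves a function that vanishes at the centre.
Its derivative there is the value of its quotient by \<^const>\<open>phi\<close>, hence in \<^const>\<open>l2\<close>.\<close>

lemma kp_remainder:
  assumes F: "F \<in> calF"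
  shows "jet 1 F - kp_map (jet 0 F) \<in> l2"
    "l2_norm (jet 1 F - kp_map (jet 0 F)) \<le> 20 * calF_norm F"
proof -
  note x = jet_0_in_l2[OF F]
  note E = extremal_in_calF[OF x(1)]
  let ?G = "F - extremal (jet 0 F)"
  have G: "?G \<in> calF" by (intro calF_diff(1) F E)
  have G0: "jet 0 ?G = 0" and G1: "jet 1 ?G = jet 1 F - kp_map (jet 0 F)"
    using F E by (simp_all add: jet_diff jet_0_extremal jet_1_extremal[simplified])
  note H = phi_quotient_in_calF[OF G G0]
  have "calF_norm (phi_quotient ?G) \<le> 10 * (calF_norm F + calF_norm (extremal (jet 0 F)))"
    using H(2) calF_diff(2)[OF F E(1)] by simp
  then have "calF_norm (phi_quotient ?G) \<le> 20 * calF_norm F" using x E by simp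
  then show "jet 1 F - kp_map (jet 0 F) \<in> l2"
    "l2_norm (jet 1 F - kp_map (jet 0 F)) \<le> 20 * calF_norm F"
    using jet_0_in_l2[OF H(1)] jet_phi_quotient(1)[OF G G0] G1 by simp_all
qed

text \<open>The converse construction: the extremal function contributes \<^term>\<open>kp_map x\<close> to the derivative,
and a multiple of \<^const>\<open>phi\<close> supplies the remainder without changing the value.\<close>

lemma kp_lift:
  assumes "(y, x) \<in> Z2"
  obtains F where "F \<in> calF" "jet_pair F = (y, x)" "calF_norm F \<le> 6 * Z2_quasinorm (y, x)"
proof -
  have x: "x \<in> l2" and d: "y - kp_map x \<in> l2" using assms by (auto simp: Z2_def)
  note E = extremal_in_calF[OF d] and Ex = extremal_in_calF[OF x]
  note P = phi_times_in_calF[OF E(1)]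
  let ?F = "phi_times (extremal (y - kp_map x)) + extremal x"
  have "jet_pair ?F = (y, x)"
    using jet_phi_times[OF E(1)]
    by (simp add: jet_pair_def jet_add P Ex jet_0_extremal jet_1_extremal[simplified])
  moreover have "calF_norm ?F \<le> 6 * Z2_quasinorm (y, x)"
    using calF_add(2)[OF P(1) Ex(1)] P(2) E(2) Ex(2) l2_norm_nonneg[OF x]
    by (simp add: Z2_quasinorm_def)
  ultimately show ?thesis using that calF_add(1)[OF P(1) Ex(1)] by blast
qed

lemma Z2_eq: "jet_pair ` calF = Z2"
proof
  show "jet_pair ` calF \<subseteq> Z2"
    using kp_remainder(1) jet_0_in_l2(1) jet_in_linf by (auto simp: Z2_def jet_pair_def)
  show "Z2 \<subseteq> jet_pair ` calF" using kp_lift by (metis imageI prod.collapse subsetI)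
qed

lemma equivalent_on_Z2: "equivalent_on Z2 Z2_quasinorm Z2_norm"
  unfolding equivalent_on_def
proof (rule exI[of _ "1/21"], intro conjI exI[of _ 6] ballI)
  fix z assume z: "z \<in> Z2"
  show "1/21 * Z2_quasinorm z \<le> Z2_norm z"
  proof (rule Z2.quotient_norm_greatest)
    fix F assume "F \<in> calF" "jet_pair F = z"
    then show "1/21 * Z2_quasinorm z \<le> calF_norm F"
      using kp_remainder(2)[of F] jet_0_in_l2(2)[of F]
      by (auto simp: jet_pair_def Z2_quasinorm_def)
  qed (simp add: z Z2_eq)
  obtain y x where yx: "z = (y, x)" by force
  obtain F where "F \<in> calF" "jet_pair F = (y, x)" "calF_norm F \<le> 6 * Z2_quasinorm (y, x)"
    using kp_lift z yx by metis
  then show "Z2_norm z \<le> 6 * Z2_quasinorm z"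
    using Z2.quotient_norm_le[of F] yx by simp
qed auto

text \<open>Zero beyond \<open>n\<close> to match the encoding of tuples in \<^const>\<open>calZ\<close>; thus \<^term>\<open>calZ n\<close> is the image of
\<^const>\<open>calF\<close>.\<close>

definition taylor :: "nat \<Rightarrow> (complex \<Rightarrow> cseq) \<Rightarrow> nat \<Rightarrow> cseq" where
  "taylor n F = (\<lambda>i. if i < n then inverse (fact i) *\<^sub>C jet i F else 0)"

interpretation taylor: quotient_map calF calF_norm "taylor n" for n
proof
  fix F assume "F \<in> calF"
    and *: "\<And>e. e > 0 \<Longrightarrow> \<exists>G\<in>calF. taylor n G = taylor n F \<and> calF_norm G < e"
  have "jet i F = 0" if i: "i < n" for i
  proof (rule jet_separated)
    fix e :: real assume "e > 0"
    then obtain G where G: "G \<in> calF" "taylor n G = taylor n F" "calF_norm G < e" using * by blast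
    have "inverse (fact i) *\<^sub>C jet i G = inverse (fact i) *\<^sub>C jet i F"
      using fun_cong[OF G(2), of i] i by (simp add: taylor_def)
    then have "jet i G = jet i F" by (auto simp: fun_eq_iff)
    then show "\<exists>G\<in>calF. jet i G = jet i F \<and> calF_norm G < e" using G by blast
  qed
  then show "taylor n F = 0" by (auto simp: taylor_def fun_eq_iff)
qed (auto simp: taylor_def jet_add jet_scale fun_eq_iff algebra_simps)

lemma taylor_lifts_eq:
  assumes "\<forall>i\<ge>n. x i = 0"
  shows "taylor_lifts n x = {F \<in> calF. taylor n F = x}"
  unfolding taylor_lifts_def taylor_def fun_eq_iff[of _ x]
  using assms by (auto simp: higher_linf_deriv_half not_less)

lemma calZ_eq: "taylor n ` calF = calZ n"
proof
  have "taylor n F i \<in> linf" if "F \<in> calF" for F i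
    using linf_scale[OF jet_in_linf[OF that]] csubspace_linf
    by (simp add: taylor_def csubspace_def)
  moreover have "taylor n F i = 0" if "i \<ge> n" for F i using that by (simp add: taylor_def)
  ultimately show "taylor n ` calF \<subseteq> calZ n"
    using taylor_lifts_eq unfolding calZ_def by fastforce
  show "calZ n \<subseteq> taylor n ` calF" using taylor_lifts_eq unfolding calZ_def by fastforce
qed

lemma calZ_norm_eq: "x \<in> calZ n \<Longrightarrow> quotient_norm calF calF_norm (taylor n) x = calZ_norm n x"
  unfolding quotient_norm_def calZ_norm_def by (subst taylor_lifts_eq) (auto simp: calZ_def)

lemma banach_on_calZ: "banach_on (calZ n) (calZ_norm n)"
  by (rule banach_on_cong[OF taylor.banach_on_quotient[unfolded calZ_eq] calZ_norm_eq])

lemma taylor_in_calZ: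
  assumes "F \<in> calF"
  shows "taylor n F \<in> calZ n" "calZ_norm n (taylor n F) \<le> calF_norm F"
proof -
  show "taylor n F \<in> calZ n" using assms calZ_eq by blast
  then show "calZ_norm n (taylor n F) \<le> calF_norm F"
    using taylor.quotient_norm_le[OF assms, of n] calZ_norm_eq by simp
qed

section \<open>The exact sequence\<close>

text \<open>Listed by increasing order of the Taylor coefficient: \<open>triple a b c\<close> stands for
\<open>(x\<^sub>2, x\<^sub>1, x\<^sub>0) = (c, b, a)\<close>.\<close>

definition triple :: "cseq \<Rightarrow> cseq \<Rightarrow> cseq \<Rightarrow> nat \<Rightarrow> cseq" where
  "triple a b c i = (if i = 0 then a else if i = 1 then b else if i = 2 then c else 0)"

lemma taylor_3: "taylor 3 F = triple (jet 0 F) (jet 1 F) ((1/2) *\<^sub>C jet 2 F)"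
  by (auto simp: taylor_def triple_def fun_eq_iff numeral_3_eq_3 less_Suc_eq numeral_2_eq_2)

definition inclusion :: "cseq \<times> cseq \<Rightarrow> cseq \<times> (nat \<Rightarrow> cseq)" where
  "inclusion = (\<lambda>(y, x). (x, triple 0 x y))"

definition projection :: "cseq \<times> (nat \<Rightarrow> cseq) \<Rightarrow> cseq \<times> cseq" where
  "projection = (\<lambda>(v, u). (u 1 - v, u 0))"

abbreviation middle :: "(cseq \<times> (nat \<Rightarrow> cseq)) set" where
  "middle \<equiv> l2 \<times> calZ 3"

abbreviation middle_norm :: "cseq \<times> (nat \<Rightarrow> cseq) \<Rightarrow> real" where
  "middle_norm \<equiv> sum_norm l2_norm (calZ_norm 3)"

text \<open>The inclusion lifts to multiplication by \<^const>\<open>phi\<close>, which makes it well defined and bounded.\<close>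

lemma inclusion_jet_pair:
  assumes "F \<in> calF"
  shows "inclusion (jet_pair F) = (jet 0 F, taylor 3 (phi_times F))"
  using jet_phi_times[OF assms]
  by (simp add: inclusion_def jet_pair_def taylor_3 scaleC_scaleC scaleC_one)

lemma bounded_operator_inclusion: "bounded_operator Z2 Z2_norm middle middle_norm inclusion"
  unfolding bounded_operator_def
proof (intro conjI ballI allI exI[of _ 7])
  fix z assume z: "z \<in> Z2"
  then obtain F where F: "F \<in> calF" "z = jet_pair F" unfolding Z2_eq[symmetric] by auto
  show "inclusion z \<in> middle"
    using F inclusion_jet_pair jet_0_in_l2 taylor_in_calZ(1)[OF phi_times_in_calF(1)[OF F(1)]] by simp
  have "middle_norm (inclusion z) / 7 \<le> Z2_norm z"
  proof (rule Z2.quotient_norm_greatest)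
    fix F assume F: "F \<in> calF" "jet_pair F = z"
    have "calZ_norm 3 (taylor 3 (phi_times F)) \<le> 6 * calF_norm F"
      using taylor_in_calZ(2)[OF phi_times_in_calF(1)[OF F(1)], of 3] phi_times_in_calF(2)[OF F(1)]
      by simp
    then show "middle_norm (inclusion z) / 7 \<le> calF_norm F"
      using inclusion_jet_pair[OF F(1)] F(2) jet_0_in_l2(2)[OF F(1)] by (simp add: sum_norm_def)
  qed (simp add: z Z2_eq)
  then show "middle_norm (inclusion z) \<le> 7 * Z2_norm z" by simp
next
  show "inclusion (z + w) = inclusion z + inclusion w" for z w
    by (auto simp: inclusion_def triple_def fun_eq_iff split: prod.splits)
  show "inclusion (a *\<^sub>C z) = a *\<^sub>C inclusion z" for a z
    by (auto simp: inclusion_def triple_def fun_eq_iff scaleC_prod_def split: prod.splits)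
qed

text \<open>The correction by \<open>v\<close> lifts to the subtraction of a multiple of \<^const>\<open>phi\<close> with first Taylor
coefficient \<open>v\<close>.\<close>

lemma projection_taylor:
  assumes "F \<in> calF" "v \<in> l2"
  shows "projection (v, taylor 3 F) = jet_pair (F - phi_times (extremal v))"
proof -
  note E = extremal_in_calF(1)[OF assms(2)]
  show ?thesis
    using jet_phi_times[OF E] phi_times_in_calF(1)[OF E] assms(1)
    by (simp add: projection_def taylor_3 triple_def jet_pair_def jet_diff jet_0_extremal)
qed

lemma bounded_operator_projection: "bounded_operator middle middle_norm Z2 Z2_norm projection"
  unfolding bounded_operator_def
proof (intro conjI ballI allI exI[of _ 6])
  fix b assume "b \<in> middle"
  then obtain v u where b: "b = (v, u)" "v \<in> l2" "u \<in> calZ 3" by auto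
  note E = extremal_in_calF[OF b(2)]
  note P = phi_times_in_calF[OF E(1)]
  have lift: "projection b \<in> Z2 \<and> Z2_norm (projection b) - 6 * l2_norm v \<le> calF_norm F"
    if F: "F \<in> calF" "taylor 3 F = u" for F
  proof -
    let ?G = "F - phi_times (extremal v)"
    have G: "?G \<in> calF" "calF_norm ?G \<le> calF_norm F + 6 * l2_norm v"
      using calF_diff(1)[OF F(1) P(1)] calF_diff(2)[OF F(1) P(1)] P(2) E(2) by auto
    have "projection b = jet_pair ?G" using projection_taylor F b by blast
    then show ?thesis
      using Z2.quotient_norm_le[OF G(1)] G Z2_eq by (auto simp: image_iff)
  qed
  have u: "u \<in> taylor 3 ` calF" using b by (simp add: calZ_eq)
  then show "projection b \<in> Z2" using lift by auto
  have "Z2_norm (projection b) - 6 * l2_norm v \<le> quotient_norm calF calF_norm (taylor 3) u"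
    using u lift by (intro taylor.quotient_norm_greatest) auto
  also have "\<dots> = calZ_norm 3 u" using b by (simp add: calZ_norm_eq)
  finally have le: "Z2_norm (projection b) \<le> 6 * l2_norm v + calZ_norm 3 u" by simp
  have "0 \<le> calZ_norm 3 u"
    using taylor.quotient_norm_nonneg[OF u] b by (simp add: calZ_norm_eq)
  then show "Z2_norm (projection b) \<le> 6 * middle_norm b" using le b by (simp add: sum_norm_def)
next
  show "projection (b + c) = projection b + projection c" for b c
    by (auto simp: projection_def split: prod.splits)
  show "projection (a *\<^sub>C b) = a *\<^sub>C projection b" for a b
    by (auto simp: projection_def scaleC_prod_def fun_eq_iff
        algebra_simps split: prod.splits)
qed

text \<open>Exactness in the middle is division by \<^const>\<open>phi\<close>: if \<open>F\<close> vanishes at the centre, its first and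
second Taylor coefficients are those of order zero and one of the quotient.\<close>

lemma inclusion_image: "inclusion ` Z2 = {b \<in> middle. projection b = 0}"
proof (intro equalityI subsetI)
  fix b assume "b \<in> inclusion ` Z2"
  then show "b \<in> {b \<in> middle. projection b = 0}"
    using bounded_operator_inclusion
    by (auto simp: bounded_operator_def inclusion_def projection_def triple_def zero_prod_def)
next
  fix b assume "b \<in> {b \<in> middle. projection b = 0}"
  then obtain v F where F: "F \<in> calF" and b: "b = (v, taylor 3 F)" "projection (v, taylor 3 F) = 0"
    by (auto simp: calZ_eq[symmetric])
  then have 0: "jet 0 F = 0" and v: "v = jet 1 F"
    by (auto simp: projection_def taylor_3 triple_def zero_prod_def)
  let ?G = "phi_quotient F"
  note G = phi_quotient_in_calF(1)[OF F 0] and jets = jet_phi_quotient[OF F 0]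
  have "taylor 3 F = triple 0 (jet 0 ?G) (jet 1 ?G)"
    using jets(1) by (simp add: taylor_3 0 jets(2)[symmetric] scaleC_scaleC scaleC_one)
  then have "b = inclusion (jet_pair ?G)"
    using b v jets(1) by (simp add: inclusion_def jet_pair_def)
  then show "b \<in> inclusion ` Z2" using G Z2_eq by blast
qed

lemma exact_sequence_Z2: "exact_sequence Z2 Z2_norm middle middle_norm Z2 Z2_norm inclusion projection"
  unfolding exact_sequence_def
proof (intro conjI)
  show "inj_on inclusion Z2"
  proof (rule inj_onI, clarify)
    fix y x y' x' assume "inclusion (y, x) = inclusion (y', x')"
    then have "x = x'" and "triple 0 x y 2 = triple 0 x' y' 2" by (auto simp: inclusion_def)
    then show "y = y' \<and> x = x'" by (simp add: triple_def)
  qed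
  show "projection ` middle = Z2"
  proof
    show "projection ` middle \<subseteq> Z2"
      using bounded_operator_projection by (auto simp: bounded_operator_def)
    show "Z2 \<subseteq> projection ` middle"
    proof
      fix z assume "z \<in> Z2"
      then obtain F where F: "F \<in> calF" "z = jet_pair F" unfolding Z2_eq[symmetric] by auto
      then have "z = projection (0, taylor 3 F)"
        by (simp add: projection_def taylor_3 triple_def jet_pair_def)
      moreover have "(0, taylor 3 F) \<in> middle"
        using taylor_in_calZ(1)[OF F(1)] csubspace_l2 by (simp add: csubspace_def)
      ultimately show "z \<in> projection ` middle" by blast
    qed
  qed
qed (use Z2.banach_on_quotient[unfolded Z2_eq] banach_on_Times[OF banach_on_l2 banach_on_calZ]
    bounded_operator_inclusion bounded_operator_projection inclusion_image in auto)

section \<open>Nontriviality\<close>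

lemma sum_fun_apply: "(\<Sum>i\<in>A. f i) k = (\<Sum>i\<in>A. f i k)"
  by (induction A rule: infinite_finite_induct) auto

text \<open>Averaging over the signs kills the off-diagonal terms.  Carrying out the average one sign at a time
gives an induction in which the constant \<open>c\<close> collects the diagonal entries.\<close>

lemma sign_average_bound:
  fixes M :: "nat \<Rightarrow> nat \<Rightarrow> complex"
  assumes "\<And>\<epsilon>. (\<And>j. \<epsilon> j = 1 \<or> \<epsilon> j = -1) \<Longrightarrow> cmod (c + (\<Sum>n<m. \<Sum>j<m. \<epsilon> n * \<epsilon> j * M n j)) \<le> B"
  shows "cmod (c + (\<Sum>n<m. M n n)) \<le> B"
  using assms
proof (induction m arbitrary: c)
  case 0
  then show ?case using "0"[of "\<lambda>_. 1"] by simp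
next
  case (Suc m)
  have "cmod ((c + M m m) + (\<Sum>n<m. M n n)) \<le> B"
  proof (rule Suc.IH)
    fix \<epsilon> :: "nat \<Rightarrow> complex" assume \<epsilon>: "\<And>j. \<epsilon> j = 1 \<or> \<epsilon> j = -1"
    define S where "S = (\<Sum>n<m. \<Sum>j<m. \<epsilon> n * \<epsilon> j * M n j)"
    define L where "L = (\<Sum>n<m. \<epsilon> n * M n m) + (\<Sum>j<m. \<epsilon> j * M m j)"
    have expand: "(\<Sum>n<Suc m. \<Sum>j<Suc m. (\<epsilon>(m := s)) n * (\<epsilon>(m := s)) j * M n j) = S + s * L + s * s * M m m"
      for s
      by (simp add: S_def L_def sum.distrib sum_distrib_left algebra_simps)
    have *: "cmod (c + (S + s * L + s * s * M m m)) \<le> B" if "s = 1 \<or> s = -1" for s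
      using Suc.prems[of "\<epsilon>(m := s)"] \<epsilon> that unfolding expand by auto
    have "2 * ((c + M m m) + S) = (c + (S + L + M m m)) + (c + (S - L + M m m))" by simp
    then have "2 * cmod ((c + M m m) + S) \<le> cmod (c + (S + L + M m m)) + cmod (c + (S - L + M m m))"
      by (metis norm_mult norm_numeral norm_triangle_ineq)
    also have "\<dots> \<le> B + B" using *[of 1] *[of "-1"] by (intro add_mono) simp_all
    finally show "cmod ((c + M m m) + (\<Sum>n<m. \<Sum>j<m. \<epsilon> n * \<epsilon> j * M n j)) \<le> B"
      by (simp add: S_def)
  qed
  then show ?case by (simp add: algebra_simps)
qed

lemma bounded_operator_sum:
  fixes m :: nat
  assumes T: "bounded_operator V NV W NW T" and V: "csubspace V"
    and v: "\<And>j. j < m \<Longrightarrow> v j \<in> V"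
  shows "T (\<Sum>j<m. a j *\<^sub>C v j) = (\<Sum>j<m. a j *\<^sub>C T (v j))"
  using v
proof (induction m)
  case 0
  have "T (0 *\<^sub>C 0) = 0 *\<^sub>C T 0" using T V unfolding bounded_operator_def csubspace_def by blast
  then show ?case by simp
next
  case (Suc m)
  have sm: "a j *\<^sub>C v j \<in> V" if "j < Suc m" for j
    using V Suc.prems that by (simp add: csubspace_def)
  then have "(\<Sum>j<m. a j *\<^sub>C v j) \<in> V" by (intro csubspace_sum V) simp
  moreover have "T (a m *\<^sub>C v m) = a m *\<^sub>C T (v m)"
    using T Suc.prems by (simp add: bounded_operator_def)
  ultimately show ?case
    using T sm[of m] Suc by (simp add: bounded_operator_def)
qed

text \<open>The duality estimates descend to \<^const>\<open>Z2\<close>.  The strict inequality allows a lift of norm below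
\<open>C\<close> to be chosen, although the infimum need not be attained.\<close>

lemma
  assumes "(y, x) \<in> Z2" "Z2_norm (y, x) < C" "b \<in> l2"
  shows Z2_pairing_value: "cmod (\<Sum>k<n. x k * b k) \<le> C * l2_norm b"
    and Z2_pairing_derivative: "cmod (\<Sum>k<n. y k * b k - x k * kp_map b k) \<le> 8 * (C * l2_norm b)"
proof -
  obtain F where F: "F \<in> calF" "jet_pair F = (y, x)" "calF_norm F < C"
    using Z2.quotient_norm_lift[of "(y, x)" C] assms(1,2) unfolding Z2_eq by blast
  have "calF_norm F * l2_norm b \<le> C * l2_norm b"
    using F(3) l2_norm_nonneg[OF assms(3)] by (intro mult_right_mono) auto
  then show "cmod (\<Sum>k<n. x k * b k) \<le> C * l2_norm b"
    "cmod (\<Sum>k<n. y k * b k - x k * kp_map b k) \<le> 8 * (C * l2_norm b)"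
    using pairing_value[OF F(1) assms(3), of n] pairing_derivative[OF F(1) assms(3), of n] F(2)
    by (auto simp: jet_pair_def)
qed

lemma Z2_finite_support:
  assumes "\<And>k. k \<ge> n \<Longrightarrow> x k = 0" "\<And>k. k \<ge> n \<Longrightarrow> y k = 0"
  shows "(y, x) \<in> Z2"
proof -
  have y: "y \<in> l2" and x: "x \<in> l2" using assms by (auto intro: l2_finite_support)
  have "y - kp_map x \<in> l2"
    using assms by (intro l2_finite_support(1)[of n]) (simp add: kp_map_def)
  moreover have "y \<in> linf" unfolding linf_iff using coordinate_le_l2_norm[OF y] by blast
  ultimately show ?thesis using x by (simp add: Z2_def)
qed

definition unit_seq :: "nat \<Rightarrow> cseq" where
  "unit_seq j = (\<lambda>k. if k = j then 1 else 0)"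

lemma unit_seq_l2: "unit_seq j \<in> l2" "l2_norm (unit_seq j) = 1"
  using l2_finite_support[of "Suc j" "unit_seq j"] by (auto simp: unit_seq_def if_distrib cong: if_cong)

lemma kp_map_unit_seq: "kp_map (unit_seq j) = 0"
  by (auto simp: kp_map_def unit_seq_l2 fun_eq_iff) (auto simp: unit_seq_def)

lemma taylor_extremal_unit_seq: "taylor 3 (extremal (unit_seq j)) = triple (unit_seq j) 0 0"
proof -
  have "jet i (extremal (unit_seq j)) = 0" if "i > 0" for i
    using that by (auto simp: jet_extremal unit_seq_l2 fun_eq_iff) (auto simp: unit_seq_def)
  then show ?thesis by (simp add: taylor_3 jet_0_extremal)
qed

text \<open>\<open>R\<close> and \<open>T\<close> record the left inverse \<open>P\<close> on the unit vectors of \<^const>\<open>l2\<close> and of the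
coefficient of order zero.  \<open>A\<close> and \<open>B\<close> are the two tests described at the beginning: the part of
\<open>P (x, 0)\<close> with the unbounded factor \<open>l\<close> occurs in both and cancels in \<open>A - B\<close>.\<close>

theorem not_trivial_sequence_Z2: "\<not> trivial_sequence Z2 Z2_norm middle middle_norm inclusion"
proof
  assume "trivial_sequence Z2 Z2_norm middle middle_norm inclusion"
  then obtain P where P: "bounded_operator middle middle_norm Z2 Z2_norm P"
    and PI: "\<And>z. z \<in> Z2 \<Longrightarrow> P (inclusion z) = z"
    by (auto simp: trivial_sequence_def)
  have PZ: "P b \<in> Z2" if "b \<in> middle" for b
    using P that unfolding bounded_operator_def by blast
  have Padd: "P (b + c) = P b + P c" if "b \<in> middle" "c \<in> middle" for b c
    using P that unfolding bounded_operator_def by blast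
  have Pscale: "P (a *\<^sub>C b) = a *\<^sub>C P b" if "b \<in> middle" for a b
    using P that unfolding bounded_operator_def by blast
  obtain K0 where K0: "\<And>b. b \<in> middle \<Longrightarrow> Z2_norm (P b) \<le> K0 * middle_norm b"
    using P unfolding bounded_operator_def by blast
  have mid: "banach_on middle middle_norm" by (intro banach_on_Times banach_on_l2 banach_on_calZ)
  then have sub: "csubspace middle" and mid_nonneg: "\<And>b. b \<in> middle \<Longrightarrow> 0 \<le> middle_norm b"
    by (auto simp: banach_on_def norm_on_def)
  have mid_add: "b + c \<in> middle" if "b \<in> middle" "c \<in> middle" for b c
    using sub that unfolding csubspace_def by blast
  have zero: "0 \<in> calZ 3" "calZ_norm 3 0 = 0"
    using banach_on_calZ[of 3] by (auto simp: banach_on_def norm_on_def csubspace_def)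
  have l2_zero: "0 \<in> l2" "l2_norm 0 = 0"
    using banach_on_l2 by (auto simp: banach_on_def norm_on_def csubspace_def)
  define K where "K = \<bar>K0\<bar> + 1"
  have K: "K \<ge> 1" by (simp add: K_def)
  have less: "Z2_norm (P b) < K * s" if "b \<in> middle" "middle_norm b \<le> s" "s > 0" for b s
  proof -
    have "Z2_norm (P b) \<le> \<bar>K0\<bar> * middle_norm b"
      using K0[OF that(1)] mult_right_mono[OF abs_ge_self mid_nonneg[OF that(1)], of K0] by simp
    also have "\<dots> \<le> \<bar>K0\<bar> * s" using that by (intro mult_left_mono) auto
    also have "\<dots> < K * s" using that by (simp add: K_def algebra_simps)
    finally show ?thesis .
  qed
  define R where "R j = P (unit_seq j, 0)" for j
  define T where "T j = P (0, triple (unit_seq j) 0 0)" for j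
  have unit_mid: "(unit_seq j, 0) \<in> middle" "middle_norm (unit_seq j, 0) = 1" for j
    using zero unit_seq_l2 by (auto simp: sum_norm_def)
  have trip_mid: "(0, triple (unit_seq j) 0 0) \<in> middle" "middle_norm (0, triple (unit_seq j) 0 0) \<le> 1" for j
    using taylor_in_calZ[OF extremal_in_calF(1)[OF unit_seq_l2(1)], of 3 j]
      extremal_in_calF(2)[OF unit_seq_l2(1), of j] l2_zero
    by (auto simp: taylor_extremal_unit_seq unit_seq_l2 sum_norm_def)
  \<comment> \<open>Testing against unit vectors, where \<^const>\<open>kp_map\<close> vanishes, bounds the diagonal entries.\<close>
  have sum_unit: "(\<Sum>k<Suc j. z k * unit_seq j k) = z j" for z j
    by (simp add: unit_seq_def if_distrib cong: if_cong)
  have diag: "cmod (snd (T j) j - fst (R j) j) \<le> 9 * K" for j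
  proof -
    have "R j \<in> Z2" "Z2_norm (R j) < K * 1" "T j \<in> Z2" "Z2_norm (T j) < K * 1"
      unfolding R_def T_def
      by (intro PZ less unit_mid(1) trip_mid order_eq_refl[OF unit_mid(2)] zero_less_one)+
    then have "cmod (\<Sum>k<Suc j. snd (T j) k * unit_seq j k) \<le> K * 1 * l2_norm (unit_seq j)"
      "cmod (\<Sum>k<Suc j. fst (R j) k * unit_seq j k - snd (R j) k * kp_map (unit_seq j) k)
        \<le> 8 * (K * 1 * l2_norm (unit_seq j))"
      by (intro Z2_pairing_value[of "fst (T j)"] Z2_pairing_derivative unit_seq_l2; simp)+
    then have "cmod (snd (T j) j) \<le> K" "cmod (fst (R j) j) \<le> 8 * K"
      by (simp_all only: kp_map_unit_seq zero_fun_apply mult_zero_right diff_0_right sum_unit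
          unit_seq_l2 mult_1_right)
    then show ?thesis using norm_triangle_ineq4[of "snd (T j) j" "fst (R j) j"] by linarith
  qed
  define M where "M k j = snd (T j) k - fst (R j) k" for k j
  have key: "ln (real m) \<le> 18 * K" if m: "m \<ge> 1" for m :: nat
  proof -
    define l where "l = - complex_of_real (ln (real m))"
    have "cmod (l * of_nat m + (\<Sum>n<m. M n n)) \<le> 9 * K * m"
    proof (rule sign_average_bound[where M = M])
      fix \<epsilon> :: "nat \<Rightarrow> complex" assume \<epsilon>: "\<And>j. \<epsilon> j = 1 \<or> \<epsilon> j = -1"
      have cmod_\<epsilon>: "cmod (\<epsilon> j) = 1" for j using \<epsilon>[of j] by auto
      have \<epsilon>_sq: "\<epsilon> j * \<epsilon> j = 1" for j using \<epsilon>[of j] by auto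
      define x where "x k = (if k < m then \<epsilon> k else 0)" for k
      have x: "x \<in> l2" "l2_norm x = sqrt m"
        using l2_finite_support[of m x] by (simp_all add: x_def cmod_\<epsilon>)
      have x_sum: "x = (\<Sum>j<m. \<epsilon> j *\<^sub>C unit_seq j)"
        by (auto simp: fun_eq_iff sum_fun_apply x_def unit_seq_def if_distrib cong: if_cong)
      have two_ln: "2 * complex_of_real (ln (1 / sqrt m)) = l"
        using m by (simp add: l_def ln_div ln_sqrt)
      have jet: "jet i (extremal x) = l ^ i *\<^sub>C x" for i
        using two_ln by (auto simp: jet_extremal fun_eq_iff x) (auto simp: x_def cmod_\<epsilon>)
      have kp: "kp_map x = l *\<^sub>C x" using jet[of 1] jet_1_extremal by simp
      define u where "u = taylor 3 (extremal x)"
      have u: "(0, u) \<in> middle" "middle_norm (0, u) \<le> sqrt m"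
        using taylor_in_calZ[OF extremal_in_calF(1)[OF x(1)], of 3] extremal_in_calF(2)[OF x(1)] x l2_zero
        by (auto simp: u_def sum_norm_def)
      have xm: "(x, 0) \<in> middle" "middle_norm (x, 0) \<le> sqrt m"
        using x zero by (auto simp: sum_norm_def)
      have z: "((l\<^sup>2 / 2) *\<^sub>C x, l *\<^sub>C x) \<in> Z2"
        by (rule Z2_finite_support[of m]) (auto simp: x_def)
      have zi: "inclusion ((l\<^sup>2 / 2) *\<^sub>C x, l *\<^sub>C x) \<in> middle"
        using bounded_operator_inclusion z by (simp add: bounded_operator_def)
      have tx: "(0, triple x 0 0) = (\<Sum>j<m. \<epsilon> j *\<^sub>C (0, triple (unit_seq j) 0 0))"
        by (auto simp: prod_eq_iff fst_sum snd_sum scaleC_prod_def fun_eq_iff sum_fun_apply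
            triple_def x_sum)
      have x0: "(x, 0) = (\<Sum>j<m. \<epsilon> j *\<^sub>C (unit_seq j, 0 :: nat \<Rightarrow> cseq))"
        by (simp add: prod_eq_iff fst_sum snd_sum scaleC_prod_def x_sum)
      have t: "(0, triple x 0 0) \<in> middle"
        unfolding tx using sub trip_mid(1) by (intro csubspace_sum) (auto simp: csubspace_def)
      have Pt: "P (0, triple x 0 0) = (\<Sum>j<m. \<epsilon> j *\<^sub>C T j)"
        unfolding tx T_def by (rule bounded_operator_sum[OF P sub trip_mid(1)])
      have Px: "P (x, 0) = (\<Sum>j<m. \<epsilon> j *\<^sub>C R j)"
        unfolding x0 R_def by (rule bounded_operator_sum[OF P sub unit_mid(1)])
      have xs: "- l *\<^sub>C (x, 0) \<in> middle" using sub xm(1) by (simp add: csubspace_def)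
      have sum_mid: "- l *\<^sub>C (x, 0) + (0, triple x 0 0) \<in> middle"
        by (rule mid_add[OF xs t])
      \<comment> \<open>Apart from a vector in the range of the inclusion, only multiples of \<open>x\<close> remain on the right.\<close>
      have "(0, u) = inclusion ((l\<^sup>2 / 2) *\<^sub>C x, l *\<^sub>C x) + (- l *\<^sub>C (x, 0) + (0, triple x 0 0))"
        by (auto simp: u_def taylor_3 jet inclusion_def triple_def scaleC_prod_def fun_eq_iff
            power2_eq_square)
      then have "P (0, u) = P (inclusion ((l\<^sup>2 / 2) *\<^sub>C x, l *\<^sub>C x)) + P (- l *\<^sub>C (x, 0) + (0, triple x 0 0))"
        using Padd[OF zi sum_mid] by simp
      also have "P (- l *\<^sub>C (x, 0) + (0, triple x 0 0)) = - l *\<^sub>C P (x, 0) + P (0, triple x 0 0)"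
        using Padd[OF xs t] Pscale[OF xm(1)] by simp
      finally have Pu: "P (0, u) = ((l\<^sup>2 / 2) *\<^sub>C x, l *\<^sub>C x) + (- l *\<^sub>C P (x, 0) + P (0, triple x 0 0))"
        by (simp only: PI[OF z])
      have sq: "sqrt m > 0" using m by simp
      define A where "A = (\<Sum>k<m. snd (P (0, u)) k * x k)"
      define B where "B = (\<Sum>k<m. fst (P (x, 0)) k * x k - snd (P (x, 0)) k * kp_map x k)"
      have "cmod A \<le> K * sqrt m * l2_norm x"
        unfolding A_def using PZ[OF u(1)] less[OF u sq]
        by (intro Z2_pairing_value[of "fst (P (0, u))"] x) auto
      then have A: "cmod A \<le> K * m" using x by (simp add: mult.assoc)
      have "cmod B \<le> 8 * (K * sqrt m * l2_norm x)"
        unfolding B_def using PZ[OF xm(1)] less[OF xm sq] by (intro Z2_pairing_derivative x) auto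
      then have B: "cmod B \<le> 8 * (K * m)" using x by (simp add: mult.assoc)
      have "A - B = (\<Sum>k<m. l + (\<Sum>j<m. \<epsilon> k * \<epsilon> j * M k j))"
        unfolding A_def B_def sum_subtractf[symmetric]
      proof (rule sum.cong[OF refl])
        fix k assume "k \<in> {..<m}"
        then have xk: "x k = \<epsilon> k" by (simp add: x_def)
        have "snd (P (0, u)) k * x k - (fst (P (x, 0)) k * x k - snd (P (x, 0)) k * kp_map x k)
          = l * (\<epsilon> k * \<epsilon> k) + \<epsilon> k * (snd (P (0, triple x 0 0)) k - fst (P (x, 0)) k)"
          unfolding Pu kp by (simp add: xk scaleC_prod_def algebra_simps)
        also have "snd (P (0, triple x 0 0)) k - fst (P (x, 0)) k = (\<Sum>j<m. \<epsilon> j * M k j)"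
          unfolding Pt Px
          by (simp add: fst_sum snd_sum sum_fun_apply scaleC_prod_def M_def sum_subtractf[symmetric]
              right_diff_distrib)
        finally show "snd (P (0, u)) k * x k - (fst (P (x, 0)) k * x k - snd (P (x, 0)) k * kp_map x k)
          = l + (\<Sum>j<m. \<epsilon> k * \<epsilon> j * M k j)"
          by (simp only: \<epsilon>_sq mult_1_right sum_distrib_left mult.assoc)
      qed
      then have "l * of_nat m + (\<Sum>n<m. \<Sum>j<m. \<epsilon> n * \<epsilon> j * M n j) = A - B"
        by (simp add: sum.distrib mult.commute)
      then show "cmod (l * of_nat m + (\<Sum>n<m. \<Sum>j<m. \<epsilon> n * \<epsilon> j * M n j)) \<le> 9 * K * m"
        using A B norm_triangle_ineq4[of A B] by simp
    qed
    moreover have "cmod (\<Sum>n<m. M n n) \<le> (\<Sum>n<m. 9 * K)"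
      by (rule order_trans[OF norm_sum]) (intro sum_mono, simp add: M_def diag)
    moreover have "cmod (l * of_nat m) \<le> cmod (l * of_nat m + (\<Sum>n<m. M n n)) + cmod (\<Sum>n<m. M n n)"
      using norm_triangle_ineq4[of "l * of_nat m + (\<Sum>n<m. M n n)" "\<Sum>n<m. M n n"] by simp
    moreover have "cmod (l * of_nat m) = ln (real m) * m"
      using m by (simp add: l_def norm_mult)
    ultimately have "ln (real m) * m \<le> 18 * K * m" by (simp add: algebra_simps)
    then show ?thesis using m by simp
  qed
  obtain m :: nat where m: "exp (18 * K) < real m" using reals_Archimedean2 by blast
  then have "18 * K < ln (real m)" by (metis exp_gt_zero ln_exp ln_less_cancel_iff order_less_trans)
  moreover have "m \<ge> 1" using m exp_gt_zero[of "18 * K"] by (cases m) auto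
  ultimately show False using key[of m] by simp
qed

theorem proposition7:
  shows "\<exists>N. equivalent_on Z2 Z2_quasinorm N \<and>
    (\<exists>I Q.
      exact_sequence Z2 N (l2 \<times> calZ 3) (sum_norm l2_norm (calZ_norm 3)) Z2 N I Q \<and>
      \<not> trivial_sequence Z2 N (l2 \<times> calZ 3) (sum_norm l2_norm (calZ_norm 3)) I)"
  using equivalent_on_Z2 exact_sequence_Z2 not_trivial_sequence_Z2 by blast

end
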